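(* Let $\theta\in[\frac12,1]$. The full-discrete numerical scheme has a unique solution: there is a unique sequence $U^1,\dots,U^N\in V_h^0$ such that, with $U^0=Q_h\psi$, for every $n=1,\dots,N$ and every $v=\{v_0,v_b,v_n\mathbf n_e\}\in V_h^0$, $$(\overline\partial U^n,v_0)+(\Delta_w(\theta U^n+(1-\theta)U^{n-1}),\Delta_w v)=(\theta f(t_n)+(1-\theta)f(t_{n-1}),v_0).$$
   Context: Let $\Omega\subset\mathbb R^d$ ($d=2,3$) be a bounded polygonal/polyhedral domain, $\overline t>0$, $f(t)=f(t,\cdot)\in L^2(\Omega)$ for $t\in[0,\overline t]$, $\psi\in H_0^2(\Omega)$. The time step is $\tau>0$, $t_n=n\tau$, $n=0,\dots,N$, $N\tau=\overline t$, and $\overline\partial U^n:=(U^n-U^{n-1})/\tau$. $(\cdot,\cdot)$, $\|\cdot\|$ denote the $L^2(\Omega)$ inner product and norm (computed elementwise for piecewise functions); a weak function paired with $v_0$ in $(\cdot,\cdot)$ means its interior component. Mesh: $\mathcal T_h$ is a partition of $\Omega$ into polygons/polyhedra $T$ of diameter $h_T$, $h=\max_T h_T$, with edges/faces $\mathcal E_h$, shape regular in the usual weak Galerkin sense with constants independent of $h$: (A1) $|T|\ge \varrho_v h_T^d$, $|e|\ge\varrho_e h_e^{d-1}$; (A2) $h_e\ge\kappa h_T$ for $e\subset\partial T$; (A3) for every $T$ and $e\subset\partial T$ there is a pyramid in $T$ with base $e$, apex $A_e\in T$, height at least $\sigma_e h_T$, the angle between $x_e-A_e$ and the outward normal being strictly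 acute for all $x_e\in e$; (A4) each $T$ has a shape regular circumscribed simplex of diameter at most $\gamma_* h_T$ meeting only a fixed bounded number of other such simplices. For each $e\in\mathcal E_h$ fix one unit normal $\mathbf n_e$; $\mathbf n$ is the outward unit normal of $\partial T$. Spaces: for an integer $k\ge2$, $V_h=\{v=\{v_0,v_b,v_n\mathbf n_e\}: v_0|_T\in P_k(T),\ v_b|_e\in P_k(e),\ v_n|_e\in P_{k-1}(e)\}$ ($v_b,v_n$ single valued on each $e\in\mathcal E_h$), $V_h^0=\{v\in V_h: v_b|_e=0,\ v_n|_e=0 \text{ for } e\subset\partial\Omega\}$. The weak Laplacian $\Delta_w v|_T\in P_r(T)$ is defined by $(\Delta_w v,\varphi)_T=(v_0,\Delta\varphi)_T-\langle v_b,\nabla\varphi\cdot\mathbf n\rangle_{\partial T}+\langle v_n\mathbf n_e\cdot\mathbf n,\varphi\rangle_{\partial T}$ for all $\varphi\in P_r(T)$. The degree $r$ is taken large enough (depending on $k$ and the mesh regularity) that with $|||v|||^2=(\Delta_w v,\Delta_w v)$ and $\|v\|_{2,h}^2=\sum_T(\|\Delta v_0\|_T^2+h_T^{-3}\|v_0-v_b\|_{\partial T}^2+h_T^{-1}\|(\nabla v_0-v_n\mathbf n_e)\cdot\mathbf n\|_{\partial T}^2)$ one has $C_1\|v\|_{2,h}\le|||v|||\le C_2\|v\|_{2,h}$ for $v\in V_h$, with $C_1,C_2>0$ independent of $h$. Projections: $Q_0,Q_b,Q_n$ are the $L^2$ projections onto $P_k(T)$, $P_k(e)$, $P_{k-1}(e)$;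 $Q_hu=\{Q_0u,Q_bu,Q_n(\nabla u\cdot\mathbf n_e)\mathbf n_e\}$. *)

theory Defs
  imports "HOL-Analysis.Analysis"
begin

section \<open>Differential operators and polynomials\<close>

definition pderiv_at :: "'n \<Rightarrow> (real^'n \<Rightarrow> real) \<Rightarrow> real^'n \<Rightarrow> real" where
  "pderiv_at i f x = frechet_derivative f (at x) (axis i 1)"

definition grad :: "(real^'n \<Rightarrow> real) \<Rightarrow> real^'n \<Rightarrow> real^'n" where
  "grad f x = (\<chi> i. pderiv_at i f x)"

definition laplacian :: "(real^'n \<Rightarrow> real) \<Rightarrow> real^'n \<Rightarrow> real" where
  "laplacian f x = (\<Sum>i\<in>UNIV. pderiv_at i (pderiv_at i f) x)"

text \<open>Iterated partial derivatives: \<open>is\<close> lists the coordinate directions, the empty list being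
  the function itself.\<close>

definition iter_pderiv :: "'n list \<Rightarrow> (real^'n \<Rightarrow> real) \<Rightarrow> real^'n \<Rightarrow> real" where
  "iter_pderiv is f = foldr pderiv_at is f"

text \<open>Polynomial functions of total degree at most \<open>k\<close>; \<open>\<alpha>\<close> ranges over multi-indices.\<close>

definition poly_space :: "nat \<Rightarrow> (real^'n \<Rightarrow> real) set" where
  "poly_space k = {p. \<exists>c :: ('n \<Rightarrow> nat) \<Rightarrow> real.
     p = (\<lambda>x. \<Sum>\<alpha> | sum \<alpha> UNIV \<le> k. c \<alpha> * (\<Prod>i\<in>UNIV. (x $ i) ^ \<alpha> i))}"

text \<open>\<open>P\<^sub>k(e)\<close> for a flat face \<open>e\<close>: restrictions to \<open>e\<close> of polynomials, set to 0 off \<open>e\<close> so that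
  equality of functions is equality on \<open>e\<close>.\<close>

definition poly_space_on :: "nat \<Rightarrow> (real^'n) set \<Rightarrow> (real^'n \<Rightarrow> real) set" where
  "poly_space_on k e = {\<lambda>x. if x \<in> e then p x else 0 | p. p \<in> poly_space k}"


section \<open>Square integrable functions and projections\<close>

definition L2 :: "'a measure \<Rightarrow> ('a \<Rightarrow> real) \<Rightarrow> bool" where
  "L2 \<mu> g \<longleftrightarrow> g \<in> borel_measurable \<mu> \<and> integrable \<mu> (\<lambda>x. (g x)\<^sup>2)"

definition L2_proj :: "'a measure \<Rightarrow> ('a \<Rightarrow> real) set \<Rightarrow> ('a \<Rightarrow> real) \<Rightarrow> 'a \<Rightarrow> real" where
  "L2_proj \<mu> V g = (THE p. p \<in> V \<and> (\<forall>q\<in>V. (\<integral>x. p x * q x \<partial>\<mu>) = (\<integral>x. g x * q x \<partial>\<mu>)))"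

text \<open>Surface measure on a set \<open>e\<close> lying in a hyperplane with unit normal \<open>\<nu>\<close>: the volume of the
  prism \<open>A + [0,1] \<nu>\<close> of height 1 equals the surface measure of \<open>A \<subseteq> e\<close>, so the surface measure is
  the image of Lebesgue measure on the prism over \<open>e\<close> under orthogonal projection onto the
  hyperplane.\<close>

definition surface_measure :: "real^'n \<Rightarrow> (real^'n) set \<Rightarrow> (real^'n) measure" where
  "surface_measure \<nu> e =
     (let a = (SOME a. a \<in> e)
      in distr (restrict_space lborel {x + s *\<^sub>R \<nu> | x s. x \<in> e \<and> 0 \<le> s \<and> s \<le> 1}) borel
           (\<lambda>y. y - (\<nu> \<bullet> (y - a)) *\<^sub>R \<nu>))"


section \<open>The space \<open>H\<^sub>0\<^sup>2(\<Omega>)\<close> and traces\<close>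

definition test_fun :: "(real^'n) set \<Rightarrow> (real^'n \<Rightarrow> real) \<Rightarrow> bool" where
  "test_fun \<Omega> \<phi> \<longleftrightarrow> (\<forall>is x. iter_pderiv is \<phi> differentiable at x) \<and>
     (\<exists>K. compact K \<and> K \<subseteq> \<Omega> \<and> (\<forall>x. x \<notin> K \<longrightarrow> \<phi> x = 0))"

definition weak_deriv ::
    "(real^'n) set \<Rightarrow> 'n list \<Rightarrow> (real^'n \<Rightarrow> real) \<Rightarrow> (real^'n \<Rightarrow> real) \<Rightarrow> bool" where
  "weak_deriv \<Omega> is u g \<longleftrightarrow> L2 (lebesgue_on \<Omega>) g \<and>
     (\<forall>\<phi>. test_fun \<Omega> \<phi> \<longrightarrow>
        (\<integral>x. u x * iter_pderiv is \<phi> x \<partial>lebesgue_on \<Omega>)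
          = (- 1) ^ length is * (\<integral>x. g x * \<phi> x \<partial>lebesgue_on \<Omega>))"

definition H2 :: "(real^'n) set \<Rightarrow> (real^'n \<Rightarrow> real) set" where
  "H2 \<Omega> = {u. L2 (lebesgue_on \<Omega>) u \<and> (\<forall>is. length is \<le> 2 \<longrightarrow> (\<exists>g. weak_deriv \<Omega> is u g))}"

text \<open>Convergence of test functions \<open>\<phi> m\<close> to \<open>u\<close> in the norm of \<open>H\<^sup>2(\<Omega>)\<close>.\<close>

definition H2_lim :: "(real^'n) set \<Rightarrow> (nat \<Rightarrow> real^'n \<Rightarrow> real) \<Rightarrow> (real^'n \<Rightarrow> real) \<Rightarrow> bool" where
  "H2_lim \<Omega> \<phi> u \<longleftrightarrow> (\<forall>is. length is \<le> 2 \<longrightarrow> (\<exists>g. weak_deriv \<Omega> is u g \<and>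
     (\<lambda>m. \<integral>x. (iter_pderiv is (\<phi> m) x - g x)\<^sup>2 \<partial>lebesgue_on \<Omega>) \<longlonglongrightarrow> 0))"

definition H2_0 :: "(real^'n) set \<Rightarrow> (real^'n \<Rightarrow> real) set" where
  "H2_0 \<Omega> = {u \<in> H2 \<Omega>. \<exists>\<phi>. (\<forall>m. test_fun \<Omega> (\<phi> m)) \<and> H2_lim \<Omega> \<phi> u}"

text \<open>\<open>g\<close> is the trace of \<open>u \<in> H\<^sub>0\<^sup>2(\<Omega>)\<close> in \<open>L\<^sup>2(\<mu>)\<close> (\<open>\<mu>\<close> a surface measure) under a boundary operator
  \<open>B\<close> (restriction or normal derivative), obtained by extending \<open>B\<close> continuously from test
  functions.  By the trace theorem such a \<open>g\<close> exists, unique up to null sets; the value 0 in the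
  definition of \<open>face_trace\<close> is only the usual default outside the domain of definition.\<close>

definition is_face_trace ::
    "(real^'n) set \<Rightarrow> (real^'n) measure \<Rightarrow> ((real^'n \<Rightarrow> real) \<Rightarrow> real^'n \<Rightarrow> real)
      \<Rightarrow> (real^'n \<Rightarrow> real) \<Rightarrow> (real^'n \<Rightarrow> real) \<Rightarrow> bool" where
  "is_face_trace \<Omega> \<mu> B u g \<longleftrightarrow> L2 \<mu> g \<and>
     (\<forall>\<phi>. (\<forall>m. test_fun \<Omega> (\<phi> m)) \<and> H2_lim \<Omega> \<phi> u \<longrightarrow>
        (\<lambda>m. \<integral>x. (B (\<phi> m) x - g x)\<^sup>2 \<partial>\<mu>) \<longlonglongrightarrow> 0)"

definition face_trace ::
    "(real^'n) set \<Rightarrow> (real^'n) measure \<Rightarrow> ((real^'n \<Rightarrow> real) \<Rightarrow> real^'n \<Rightarrow> real)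
      \<Rightarrow> (real^'n \<Rightarrow> real) \<Rightarrow> real^'n \<Rightarrow> real" where
  "face_trace \<Omega> \<mu> B u =
     (if \<exists>g. is_face_trace \<Omega> \<mu> B u g then SOME g. is_face_trace \<Omega> \<mu> B u g else (\<lambda>_. 0))"


section \<open>Domains and meshes\<close>

text \<open>Not necessarily convex closed polytopal sets of dimension \<open>m\<close>: with \<open>m = d\<close> the closed
  polygons/polyhedra, with \<open>m = d - 1\<close> the flat edges/faces.\<close>

definition polytopal :: "int \<Rightarrow> (real^'n) set \<Rightarrow> bool" where
  "polytopal m S \<longleftrightarrow> (\<exists>F. finite F \<and> (\<forall>P\<in>F. polytope P) \<and> S = \<Union>F) \<and> aff_dim S = m \<and>
     S = closure (rel_interior S) \<and> connected (rel_interior S)"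

text \<open>Boundedness and connectedness of \<open>\<Omega>\<close> follow: \<open>\<Omega>\<close> is the interior of a compact polytopal set.\<close>

definition polytopal_domain :: "(real^'n) set \<Rightarrow> bool" where
  "polytopal_domain \<Omega> \<longleftrightarrow>
     polytopal (int CARD('n)) (closure \<Omega>) \<and> \<Omega> = interior (closure \<Omega>)"

record 'a mesh =
  cells :: "'a set set"
  faces :: "'a set set"
  normal :: "'a set \<Rightarrow> 'a"

definition cell_faces :: "(real^'n) mesh \<Rightarrow> (real^'n) set \<Rightarrow> (real^'n) set set" where
  "cell_faces M T = {e \<in> faces M. e \<subseteq> frontier T}"

definition is_outward_normal :: "(real^'n) set \<Rightarrow> (real^'n) set \<Rightarrow> real^'n \<Rightarrow> bool" where
  "is_outward_normal T e n \<longleftrightarrow> norm n = 1 \<and> (\<forall>x\<in>e. \<forall>y\<in>e. n \<bullet> (x - y) = 0) \<and>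
     (\<forall>x\<in>rel_interior e. \<exists>\<epsilon>>0. \<forall>t. 0 < t \<and> t < \<epsilon> \<longrightarrow>
        x - t *\<^sub>R n \<in> interior T \<and> x + t *\<^sub>R n \<notin> T)"

definition outward_normal :: "(real^'n) set \<Rightarrow> (real^'n) set \<Rightarrow> real^'n" where
  "outward_normal T e = (THE n. is_outward_normal T e n)"

definition is_mesh :: "(real^'n) set \<Rightarrow> (real^'n) mesh \<Rightarrow> bool" where
  "is_mesh \<Omega> M \<longleftrightarrow>
     finite (cells M) \<and> finite (faces M) \<and>
     (\<forall>T\<in>cells M. polytopal (int CARD('n)) T) \<and>
     \<Union>(cells M) = closure \<Omega> \<and>
     disjoint_family_on interior (cells M) \<and>
     (\<forall>e\<in>faces M. polytopal (int CARD('n) - 1) e) \<and>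
     disjoint_family_on rel_interior (faces M) \<and>
     (\<forall>T\<in>cells M. frontier T = \<Union>(cell_faces M T)) \<and>
     (\<forall>e\<in>faces M. \<exists>T\<in>cells M. e \<in> cell_faces M T) \<and>
     (\<forall>T\<in>cells M. \<forall>e\<in>cell_faces M T. \<exists>n. is_outward_normal T e n) \<and>
     (\<forall>e\<in>faces M. norm (normal M e) = 1 \<and> (\<forall>x\<in>e. \<forall>y\<in>e. normal M e \<bullet> (x - y) = 0))"

abbreviation surf :: "(real^'n) mesh \<Rightarrow> (real^'n) set \<Rightarrow> (real^'n) measure" where
  "surf M e \<equiv> surface_measure (normal M e) e"

text \<open>The pyramid with base \<open>e\<close> and apex \<open>A\<close> is the union of the segments from \<open>A\<close> to \<open>e\<close>.  In the
  last clause \<open>\<rho>\<^sub>s\<close> expresses shape regularity of the circumscribed simplices \<open>S T\<close> through the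
  radius of an inscribed ball.\<close>

definition shape_regular ::
    "real \<Rightarrow> real \<Rightarrow> real \<Rightarrow> real \<Rightarrow> real \<Rightarrow> real \<Rightarrow> nat \<Rightarrow> (real^'n) mesh \<Rightarrow> bool" where
  "shape_regular \<rho>\<^sub>v \<rho>\<^sub>e \<kappa> \<sigma> \<gamma> \<rho>\<^sub>s m M \<longleftrightarrow>
     (\<forall>T\<in>cells M. measure lebesgue T \<ge> \<rho>\<^sub>v * diameter T ^ CARD('n)) \<and>
     (\<forall>e\<in>faces M. measure (surf M e) e \<ge> \<rho>\<^sub>e * diameter e ^ (CARD('n) - 1)) \<and>
     (\<forall>T\<in>cells M. \<forall>e\<in>cell_faces M T. diameter e \<ge> \<kappa> * diameter T) \<and>
     (\<forall>T\<in>cells M. \<forall>e\<in>cell_faces M T. \<exists>A\<in>T.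
        (\<Union>x\<in>e. closed_segment A x) \<subseteq> T \<and>
        infdist A (affine hull e) \<ge> \<sigma> * diameter T \<and>
        (\<forall>x\<in>e. (x - A) \<bullet> outward_normal T e > 0)) \<and>
     (\<exists>S. \<forall>T\<in>cells M.
        int CARD('n) simplex (S T) \<and> T \<subseteq> S T \<and>
        (\<exists>c. cball c (\<rho>\<^sub>s * diameter (S T)) \<subseteq> S T) \<and>
        diameter (S T) \<le> \<gamma> * diameter T \<and>
        card {T' \<in> cells M. T' \<noteq> T \<and> S T' \<inter> S T \<noteq> {}} \<le> m)"

definition shape_regular_family :: "(real^'n) mesh set \<Rightarrow> bool" where
  "shape_regular_family \<M> \<longleftrightarrow>
     (\<exists>\<rho>\<^sub>v>0. \<exists>\<rho>\<^sub>e>0. \<exists>\<kappa>>0. \<exists>\<sigma>>0. \<exists>\<gamma>>0. \<exists>\<rho>\<^sub>s>0. \<exists>m.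
        \<forall>M\<in>\<M>. shape_regular \<rho>\<^sub>v \<rho>\<^sub>e \<kappa> \<sigma> \<gamma> \<rho>\<^sub>s m M)"


section \<open>Weak functions\<close>

text \<open>The components of \<open>v = {v\<^sub>0, v\<^sub>b, v\<^sub>n n\<^sub>e}\<close>, indexed by cells, faces and faces.\<close>

datatype 'a weak_fun =
  Weak (w0: "'a set \<Rightarrow> 'a \<Rightarrow> real") (wb: "'a set \<Rightarrow> 'a \<Rightarrow> real") (wn: "'a set \<Rightarrow> 'a \<Rightarrow> real")

instantiation weak_fun :: (type) real_vector
begin

definition "0 = Weak (\<lambda>_ _. 0) (\<lambda>_ _. 0) (\<lambda>_ _. 0)"
definition "u + v = Weak (\<lambda>T x. w0 u T x + w0 v T x) (\<lambda>e x. wb u e x + wb v e x)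
  (\<lambda>e x. wn u e x + wn v e x)"
definition "u - v = Weak (\<lambda>T x. w0 u T x - w0 v T x) (\<lambda>e x. wb u e x - wb v e x)
  (\<lambda>e x. wn u e x - wn v e x)"
definition "- v = Weak (\<lambda>T x. - w0 v T x) (\<lambda>e x. - wb v e x) (\<lambda>e x. - wn v e x)"
definition "a *\<^sub>R v = Weak (\<lambda>T x. a * w0 v T x) (\<lambda>e x. a * wb v e x) (\<lambda>e x. a * wn v e x)"

instance
  by standard
    (simp_all add: zero_weak_fun_def plus_weak_fun_def minus_weak_fun_def uminus_weak_fun_def
      scaleR_weak_fun_def algebra_simps)

end

text \<open>An element of \<open>P\<^sub>k(T)\<close> is represented by the unique polynomial on the whole space that
  extends it (\<open>T\<close> has nonempty interior).  Components at sets that are not cells (faces) of the mesh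
  are set to 0, so that equality in \<open>V\<^sub>h\<close> is equality of all components on the mesh.\<close>

definition Vh :: "(real^'n) mesh \<Rightarrow> nat \<Rightarrow> (real^'n) weak_fun set" where
  "Vh M k = {v.
     (\<forall>T\<in>cells M. w0 v T \<in> poly_space k) \<and>
     (\<forall>e\<in>faces M. wb v e \<in> poly_space_on k e \<and> wn v e \<in> poly_space_on (k - 1) e) \<and>
     (\<forall>T. T \<notin> cells M \<longrightarrow> w0 v T = (\<lambda>_. 0)) \<and>
     (\<forall>e. e \<notin> faces M \<longrightarrow> wb v e = (\<lambda>_. 0) \<and> wn v e = (\<lambda>_. 0))}"

definition Vh0 :: "(real^'n) set \<Rightarrow> (real^'n) mesh \<Rightarrow> nat \<Rightarrow> (real^'n) weak_fun set" where
  "Vh0 \<Omega> M k = {v \<in> Vh M k. \<forall>e\<in>faces M. e \<subseteq> frontier \<Omega> \<longrightarrow>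
     (\<forall>x\<in>e. wb v e x = 0 \<and> wn v e x = 0)}"

definition weak_laplacian ::
    "(real^'n) mesh \<Rightarrow> nat \<Rightarrow> (real^'n) weak_fun \<Rightarrow> (real^'n) set \<Rightarrow> real^'n \<Rightarrow> real" where
  "weak_laplacian M r v T = (THE w. w \<in> poly_space r \<and> (\<forall>\<phi>\<in>poly_space r.
     (\<integral>x. w x * \<phi> x \<partial>lebesgue_on T) =
       (\<integral>x. w0 v T x * laplacian \<phi> x \<partial>lebesgue_on T)
       - (\<Sum>e\<in>cell_faces M T. \<integral>x. wb v e x * (grad \<phi> x \<bullet> outward_normal T e) \<partial>surf M e)
       + (\<Sum>e\<in>cell_faces M T.
            \<integral>x. wn v e x * (normal M e \<bullet> outward_normal T e) * \<phi> x \<partial>surf M e)))"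

text \<open>The \<open>L\<^sup>2(\<Omega>)\<close> inner product of functions given cell by cell.\<close>

definition mesh_inner ::
    "'a::euclidean_space mesh \<Rightarrow> ('a set \<Rightarrow> 'a \<Rightarrow> real) \<Rightarrow> ('a set \<Rightarrow> 'a \<Rightarrow> real) \<Rightarrow> real" where
  "mesh_inner M u v = (\<Sum>T\<in>cells M. \<integral>x. u T x * v T x \<partial>lebesgue_on T)"

definition energy_norm :: "(real^'n) mesh \<Rightarrow> nat \<Rightarrow> (real^'n) weak_fun \<Rightarrow> real" where
  "energy_norm M r v = sqrt (mesh_inner M (weak_laplacian M r v) (weak_laplacian M r v))"

definition norm_2h :: "(real^'n) mesh \<Rightarrow> (real^'n) weak_fun \<Rightarrow> real" where
  "norm_2h M v = sqrt (\<Sum>T\<in>cells M.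
     (\<integral>x. (laplacian (w0 v T) x)\<^sup>2 \<partial>lebesgue_on T)
     + (\<Sum>e\<in>cell_faces M T. \<integral>x. (w0 v T x - wb v e x)\<^sup>2 \<partial>surf M e) / diameter T ^ 3
     + (\<Sum>e\<in>cell_faces M T.
          \<integral>x. ((grad (w0 v T) x - wn v e x *\<^sub>R normal M e) \<bullet> outward_normal T e)\<^sup>2 \<partial>surf M e)
         / diameter T)"

definition norms_equivalent :: "(real^'n) mesh set \<Rightarrow> nat \<Rightarrow> nat \<Rightarrow> bool" where
  "norms_equivalent \<M> k r \<longleftrightarrow> (\<exists>C\<^sub>1>0. \<exists>C\<^sub>2>0. \<forall>M\<in>\<M>. \<forall>v\<in>Vh M k.
     C\<^sub>1 * norm_2h M v \<le> energy_norm M r v \<and> energy_norm M r v \<le> C\<^sub>2 * norm_2h M v)"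

definition Qh ::
    "(real^'n) set \<Rightarrow> (real^'n) mesh \<Rightarrow> nat \<Rightarrow> (real^'n \<Rightarrow> real) \<Rightarrow> (real^'n) weak_fun" where
  "Qh \<Omega> M k u = Weak
     (\<lambda>T. if T \<in> cells M then L2_proj (lebesgue_on T) (poly_space k) u else (\<lambda>_. 0))
     (\<lambda>e. if e \<in> faces M
       then L2_proj (surf M e) (poly_space_on k e) (face_trace \<Omega> (surf M e) (\<lambda>\<phi>. \<phi>) u)
       else (\<lambda>_. 0))
     (\<lambda>e. if e \<in> faces M
       then L2_proj (surf M e) (poly_space_on (k - 1) e)
              (face_trace \<Omega> (surf M e) (\<lambda>\<phi> x. grad \<phi> x \<bullet> normal M e) u)
       else (\<lambda>_. 0))"

end

theory Submission
  imports Defs "HOL-Library.Function_Algebras"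
begin

text \<open>
  Given \<open>w = U\<^sup>n\<^sup>-\<^sup>1\<close>, the equation for \<open>u = U\<^sup>n\<close> is a square linear system in the finite dimensional
  space \<open>V\<^sub>h\<^sup>0\<close>: find \<open>u\<close> with \<open>a u v = L v\<close> for all \<open>v\<close>, where
  \<open>a u v = (u\<^sub>0, v\<^sub>0) / \<tau> + \<theta> (\<Delta>\<^sub>w u, \<Delta>\<^sub>w v)\<close> and the functional \<open>L\<close> collects the data.  Such a system is
  uniquely solvable as soon as \<open>a\<close> is definite (\<open>ex1_representer\<close>).  If \<open>a u u = 0\<close>, then \<open>u\<^sub>0\<close> has norm
  zero in \<open>L\<^sup>2\<close> and \<open>u\<close> has energy norm zero, because \<open>\<tau>\<close> and \<open>\<theta>\<close> are positive.  The energy norm dominates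
  \<open>norm_2h\<close>, so all differences \<open>u\<^sub>0 - u\<^sub>b\<close> and \<open>(\<nabla> u\<^sub>0 - u\<^sub>n n\<^sub>e) \<bullet> n\<close> vanish, and with \<open>u\<^sub>0 = 0\<close> also \<open>u\<^sub>b\<close> and \<open>u\<^sub>n\<close> do
  (\<open>norm_2h_definite\<close>).  Thus \<open>u = 0\<close>, each step has a unique solution (\<open>theta_step_ex1\<close>), and
  the sequence follows by recursion (\<open>ex1_recursive_sequence\<close>).

  The analysis behind this is that an element of a polynomial space is determined by its values up to
  null sets, on a cell (\<open>poly_space_definite_on_cell\<close>) and on a face with respect to its surface measure
  (\<open>poly_space_on_definite\<close>).  This turns zero norms into zero functions.  It also shows, through the
  same representation theorem, that the \<open>L\<^sup>2\<close> projections and the weak Laplacian, which are defined by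
  definite descriptions, exist, that the weak Laplacian is linear on \<open>V\<^sub>h\<close>
  (\<open>weak_laplacian_linear\<close>), and that the initial value lies in \<open>V\<^sub>h\<close> (\<open>Qh_in_Vh\<close>).
\<close>

section \<open>Linear and bilinear forms on subspaces\<close>

text \<open>The integrals below are linear only where the integrands are integrable, so linearity is
  required only on a subspace \<open>V\<close>; the form may take arbitrary values elsewhere.\<close>

definition linear_form_on :: "'v::real_vector set \<Rightarrow> ('v \<Rightarrow> real) \<Rightarrow> bool" where
  "linear_form_on V L \<longleftrightarrow> (\<forall>u\<in>V. \<forall>v\<in>V. L (u + v) = L u + L v) \<and> (\<forall>c. \<forall>v\<in>V. L (c *\<^sub>R v) = c * L v)"

definition bilinear_form_on :: "'v::real_vector set \<Rightarrow> ('v \<Rightarrow> 'v \<Rightarrow> real) \<Rightarrow> bool" where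
  "bilinear_form_on V a \<longleftrightarrow>
     (\<forall>v\<in>V. linear_form_on V (\<lambda>u. a u v)) \<and> (\<forall>u\<in>V. linear_form_on V (a u))"

lemma linear_form_onI:
  assumes "\<And>u v. u \<in> V \<Longrightarrow> v \<in> V \<Longrightarrow> L (u + v) = L u + L v"
    and "\<And>c v. v \<in> V \<Longrightarrow> L (c *\<^sub>R v) = c * L v"
  shows "linear_form_on V L"
  using assms by (auto simp: linear_form_on_def)

lemma linear_form_on_add:
  "linear_form_on V L \<Longrightarrow> u \<in> V \<Longrightarrow> v \<in> V \<Longrightarrow> L (u + v) = L u + L v"
  by (auto simp: linear_form_on_def)

lemma linear_form_on_scale:
  "linear_form_on V L \<Longrightarrow> v \<in> V \<Longrightarrow> L (c *\<^sub>R v) = c * L v"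
  by (auto simp: linear_form_on_def)

lemma linear_form_on_diff:
  assumes "subspace V" "linear_form_on V L" "u \<in> V" "v \<in> V"
  shows "L (u - v) = L u - L v"
proof -
  have "(-1) *\<^sub>R v \<in> V" using assms(1,4) by (rule subspace_scale)
  then have "L (u + (-1) *\<^sub>R v) = L u + (-1) * L v"
    using assms by (simp only: linear_form_on_add linear_form_on_scale)
  then show ?thesis by simp
qed

lemma linear_form_on_plus:
  "linear_form_on V L \<Longrightarrow> linear_form_on V L' \<Longrightarrow> linear_form_on V (\<lambda>v. L v + L' v)"
  by (simp add: linear_form_on_def algebra_simps)

lemma linear_form_on_minus:
  "linear_form_on V L \<Longrightarrow> linear_form_on V L' \<Longrightarrow> linear_form_on V (\<lambda>v. L v - L' v)"
  by (simp add: linear_form_on_def algebra_simps)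

lemma linear_form_on_times:
  "linear_form_on V L \<Longrightarrow> linear_form_on V (\<lambda>v. c * L v)"
  by (simp add: linear_form_on_def algebra_simps)

lemma linear_form_on_sum:
  "(\<And>i. i \<in> I \<Longrightarrow> linear_form_on V (L i)) \<Longrightarrow> linear_form_on V (\<lambda>v. \<Sum>i\<in>I. L i v)"
  by (simp add: linear_form_on_def sum.distrib sum_distrib_left)

lemma linear_form_on_integral:
  assumes "\<And>v. v \<in> V \<Longrightarrow> integrable \<mu> (G v)"
    and "\<And>u v x. u \<in> V \<Longrightarrow> v \<in> V \<Longrightarrow> G (u + v) x = G u x + G v x"
    and "\<And>c v x. v \<in> V \<Longrightarrow> G (c *\<^sub>R v) x = c * G v x"
  shows "linear_form_on V (\<lambda>v. \<integral>x. G v x \<partial>\<mu>)"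
  using assms by (intro linear_form_onI) (simp_all add: Bochner_Integration.integral_add)

lemma linear_form_on_subset: "linear_form_on V L \<Longrightarrow> W \<subseteq> V \<Longrightarrow> linear_form_on W L"
  by (simp add: linear_form_on_def subset_iff)

lemma bilinear_form_onI:
  assumes "\<And>v. v \<in> V \<Longrightarrow> linear_form_on V (\<lambda>u. a u v)" "\<And>u. u \<in> V \<Longrightarrow> linear_form_on V (a u)"
  shows "bilinear_form_on V a"
  using assms by (auto simp: bilinear_form_on_def)

lemma linear_form_on_eq_span:
  assumes "subspace V" "linear_form_on V L" "linear_form_on V L'" "B \<subseteq> V"
    and "\<And>v. v \<in> B \<Longrightarrow> L v = L' v" and "v \<in> span B"
  shows "L v = L' v"
proof -
  have "L 0 = 0" "L' 0 = 0"
    using linear_form_on_scale[OF assms(2) subspace_0[OF assms(1)], of 0]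
      linear_form_on_scale[OF assms(3) subspace_0[OF assms(1)], of 0] by simp_all
  from \<open>v \<in> span B\<close> have "v \<in> V \<and> L v = L' v"
  proof (induction rule: span_induct_alt)
    case base
    show ?case using \<open>L 0 = 0\<close> \<open>L' 0 = 0\<close> subspace_0[OF assms(1)] by simp
  next
    case (step c b y)
    then have bV: "b \<in> V" "y \<in> V" "c *\<^sub>R b \<in> V" "c *\<^sub>R b + y \<in> V"
      using assms(1,4) by (auto intro: subspace_scale subspace_add)
    show ?case
      using step bV assms(5) by (simp add: linear_form_on_add[OF assms(2)] linear_form_on_add[OF assms(3)]
          linear_form_on_scale[OF assms(2)] linear_form_on_scale[OF assms(3)])
  qed
  then show ?thesis ..
qed

text \<open>Solutions are built one generator at a time, in the manner of Gram--Schmidt: if \<open>u\<close> solves the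
  problem on \<open>span B\<close>, it is corrected by a multiple of a vector \<open>d \<in> b + span B\<close> with \<open>a d v = 0\<close> for
  all \<open>v \<in> span B\<close>.  The correction does not disturb the equations already solved, and \<open>a d d \<noteq> 0\<close>
  lets the multiple be chosen so that the equation for \<open>b\<close> holds.  The functional \<open>L\<close> has to
  be arbitrary in the induction because \<open>d\<close> arises from the induction hypothesis for \<open>a b\<close>.\<close>

lemma ex_representer_span:
  assumes V: "subspace V" and a: "bilinear_form_on V a"
    and definite: "\<And>u. u \<in> V \<Longrightarrow> a u u = 0 \<Longrightarrow> u = 0"
    and "finite B" "B \<subseteq> V" "linear_form_on V L"
  shows "\<exists>u\<in>span B. \<forall>v\<in>span B. a u v = L v"
  using assms(4-)
proof (induction B arbitrary: L rule: finite_induct)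
  case empty
  have a0: "linear_form_on V (a 0)" using a subspace_0[OF V] by (simp add: bilinear_form_on_def)
  show ?case
    using linear_form_on_scale[OF a0 subspace_0[OF V], of 0]
      linear_form_on_scale[OF empty(2) subspace_0[OF V], of 0] by simp
next
  case (insert b B)
  have bV: "b \<in> V" and BV: "B \<subseteq> V" and SV: "span B \<subseteq> V"
    using insert.prems V by (auto simp: span_minimal)
  have lin1: "linear_form_on V (\<lambda>u. a u v)" if "v \<in> V" for v
    using a that by (simp add: bilinear_form_on_def)
  have lin2: "linear_form_on V (a u)" if "u \<in> V" for u
    using a that by (simp add: bilinear_form_on_def)
  obtain u where u: "u \<in> span B" "\<And>v. v \<in> span B \<Longrightarrow> a u v = L v"
    using insert.IH[OF BV insert.prems(2)] by blast
  obtain c where c: "c \<in> span B" "\<And>v. v \<in> span B \<Longrightarrow> a c v = a b v"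
    using insert.IH[OF BV lin2[OF bV]] by blast
  define d where "d = b - c"
  have uV: "u \<in> V" and cV: "c \<in> V" using u(1) c(1) SV by auto
  have dV: "d \<in> V" unfolding d_def using V bV cV by (rule subspace_diff)
  have d0: "a d v = 0" if "v \<in> span B" for v
    using linear_form_on_diff[OF V lin1 bV cV, of v] c(2)[OF that] that SV by (auto simp: d_def)
  have dd: "a d d = a d b"
    using linear_form_on_diff[OF V lin2[OF dV] bV cV] d0[OF c(1)] by (simp add: d_def)
  define t where "t = (L b - a u b) / a d b"
  define u' where "u' = u + t *\<^sub>R d"
  have tdV: "t *\<^sub>R d \<in> V" using V dV by (rule subspace_scale)
  have u'V: "u' \<in> V" unfolding u'_def using V uV tdV by (rule subspace_add)
  have a': "a u' v = a u v + t * a d v" if "v \<in> V" for v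
    using linear_form_on_add[OF lin1[OF that] uV tdV] linear_form_on_scale[OF lin1[OF that] dV]
    by (simp add: u'_def)
  have "a u' v = L v" if "v \<in> insert b B" for v
  proof (cases "v = b")
    case False
    then show ?thesis using that a'[of v] BV d0[of v] u(2)[of v] by (auto simp: span_base)
  next
    case True
    show ?thesis
    proof (cases "d = 0")
      case True
      \<comment> \<open>Here \<open>b\<close> already lies in the span of \<open>B\<close>.\<close>
      then have "b \<in> span B" using c(1) by (simp add: d_def)
      then show ?thesis using \<open>v = b\<close> a'[OF bV] d0[of b] u(2)[of b] by simp
    next
      case False
      then have "a d b \<noteq> 0" using dd definite[OF dV] by auto
      then show ?thesis using \<open>v = b\<close> a'[OF bV] by (simp add: t_def)
    qed
  qed
  then have "\<forall>v\<in>span (insert b B). a u' v = L v"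
    using linear_form_on_eq_span[OF V lin2[OF u'V] insert.prems(2,1)] by blast
  moreover have "u' \<in> span (insert b B)"
    unfolding u'_def d_def using u(1) c(1)
    by (intro span_add span_scale span_diff span_base[of b]) (auto intro: span_mono[THEN subsetD, of B])
  ultimately show ?case by blast
qed

text \<open>The finite dimensional Lax--Milgram theorem: a definite form represents every linear functional,
  and uniqueness is definiteness applied to the difference of two representers.\<close>

proposition ex1_representer:
  assumes V: "subspace V" and fin: "finite C" "V \<subseteq> span C" and a: "bilinear_form_on V a"
    and definite: "\<And>u. u \<in> V \<Longrightarrow> a u u = 0 \<Longrightarrow> u = 0"
    and L: "linear_form_on V L"
  shows "\<exists>!u. u \<in> V \<and> (\<forall>v\<in>V. a u v = L v)"
proof -
  obtain B where B: "B \<subseteq> V" "independent B" "V \<subseteq> span B"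
    using basis_exists[of V] by metis
  have "B \<subseteq> span C" using B(1) fin(2) by blast
  then have "finite B" using independent_span_bound[OF fin(1) B(2)] by blast
  have VB: "span B = V" using B(1,3) V by (simp add: span_subspace)
  obtain u where u: "u \<in> V" "\<forall>v\<in>V. a u v = L v"
    using ex_representer_span[OF V a definite \<open>finite B\<close> B(1) L] VB by auto
  moreover have "w = u" if w: "w \<in> V" "\<forall>v\<in>V. a w v = L v" for w
  proof -
    have wu: "w - u \<in> V" using V w(1) u(1) by (rule subspace_diff)
    then have "linear_form_on V (\<lambda>x. a x (w - u))" using a by (simp add: bilinear_form_on_def)
    then have "a (w - u) (w - u) = a w (w - u) - a u (w - u)"
      by (rule linear_form_on_diff[OF V _ w(1) u(1)])
    then have "a (w - u) (w - u) = 0" using w(2) u(2) wu by simp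
    then show ?thesis using definite[OF wu] by simp
  qed
  ultimately show ?thesis by blast
qed

section \<open>Functions as vectors\<close>

text \<open>Functions form a real vector space, so that spaces of polynomials are subspaces in the sense of
  the linear algebra above.\<close>

instantiation "fun" :: (type, real_vector) real_vector
begin

definition "c *\<^sub>R f = (\<lambda>x. c *\<^sub>R f x)"

instance
  by standard (simp_all add: scaleR_fun_def fun_eq_iff algebra_simps)

end

lemma scaleR_fun_apply [simp]: "(c *\<^sub>R f) x = c *\<^sub>R f x"
  by (simp add: scaleR_fun_def)

lemma sum_fun_eq: "(\<Sum>i\<in>I. F i) = (\<lambda>x. \<Sum>i\<in>I. F i x :: 'b::comm_monoid_add)"
  by (induction I rule: infinite_finite_induct) (auto simp: fun_eq_iff)

section \<open>Polynomials\<close>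

lemma finite_multi_indices: "finite {\<alpha> :: 'n::finite \<Rightarrow> nat. sum \<alpha> UNIV \<le> k}"
proof (rule finite_subset)
  show "{\<alpha> :: 'n \<Rightarrow> nat. sum \<alpha> UNIV \<le> k} \<subseteq> UNIV \<rightarrow>\<^sub>E {..k}"
  proof
    fix \<alpha> :: "'n \<Rightarrow> nat"
    assume \<alpha>: "\<alpha> \<in> {\<alpha>. sum \<alpha> UNIV \<le> k}"
    have "\<alpha> i \<le> k" for i
      using member_le_sum[of i UNIV \<alpha>] \<alpha> by simp
    then show "\<alpha> \<in> UNIV \<rightarrow>\<^sub>E {..k}" by auto
  qed
  show "finite (UNIV \<rightarrow>\<^sub>E {..k} :: ('n \<Rightarrow> nat) set)" by (rule finite_PiE) auto
qed

definition monomials :: "nat \<Rightarrow> (real^'n \<Rightarrow> real) set" where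
  "monomials k = (\<lambda>\<alpha> x. \<Prod>i\<in>UNIV. (x $ i) ^ \<alpha> i) ` {\<alpha>. sum \<alpha> UNIV \<le> k}"

lemma finite_monomials: "finite (monomials k)"
  unfolding monomials_def using finite_multi_indices by (rule finite_imageI)

lemma poly_space_subset_span: "poly_space k \<subseteq> span (monomials k)"
proof
  fix p :: "real^'n \<Rightarrow> real" assume "p \<in> poly_space k"
  then obtain c where "p = (\<lambda>x. \<Sum>\<alpha> | sum \<alpha> UNIV \<le> k. c \<alpha> * (\<Prod>i\<in>UNIV. (x $ i) ^ \<alpha> i))"
    by (auto simp: poly_space_def)
  also have "\<dots> = (\<Sum>\<alpha> | sum \<alpha> UNIV \<le> k. c \<alpha> *\<^sub>R (\<lambda>x. \<Prod>i\<in>UNIV. (x $ i) ^ \<alpha> i))"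
    by (simp add: sum_fun_eq)
  also have "\<dots> \<in> span (monomials k)"
    by (intro span_sum span_scale span_base) (auto simp: monomials_def)
  finally show "p \<in> span (monomials k)" .
qed

lemma subspace_poly_space: "subspace (poly_space k :: (real^'n \<Rightarrow> real) set)"
proof (rule subspaceI)
  show "0 \<in> (poly_space k :: (real^'n \<Rightarrow> real) set)"
    by (auto simp: poly_space_def fun_eq_iff intro!: exI[of _ "\<lambda>_. 0"])
  fix p q :: "real^'n \<Rightarrow> real" and a :: real
  assume p: "p \<in> poly_space k"
  then obtain c where c: "p = (\<lambda>x. \<Sum>\<alpha> | sum \<alpha> UNIV \<le> k. c \<alpha> * (\<Prod>i\<in>UNIV. (x $ i) ^ \<alpha> i))"
    by (auto simp: poly_space_def)
  show "a *\<^sub>R p \<in> poly_space k"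
    unfolding poly_space_def
    by (rule CollectI, rule exI[of _ "\<lambda>\<alpha>. a * c \<alpha>"]) (simp add: c fun_eq_iff sum_distrib_left mult.assoc)
  assume "q \<in> poly_space k"
  then obtain d where d: "q = (\<lambda>x. \<Sum>\<alpha> | sum \<alpha> UNIV \<le> k. d \<alpha> * (\<Prod>i\<in>UNIV. (x $ i) ^ \<alpha> i))"
    by (auto simp: poly_space_def)
  show "p + q \<in> poly_space k"
    unfolding poly_space_def
    by (rule CollectI, rule exI[of _ "\<lambda>\<alpha>. c \<alpha> + d \<alpha>"])
      (simp add: c d fun_eq_iff sum.distrib distrib_right)
qed

lemma real_polynomial_function_poly_space:
  assumes "p \<in> poly_space k" shows "real_polynomial_function p"
proof -
  obtain c where c: "p = (\<lambda>x. \<Sum>\<alpha> | sum \<alpha> UNIV \<le> k. c \<alpha> * (\<Prod>i\<in>UNIV. (x $ i) ^ \<alpha> i))"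
    using assms by (auto simp: poly_space_def)
  have "real_polynomial_function (\<lambda>x::real^'a. x $ i)" for i
    by (rule real_polynomial_function.intros(1)) (rule bounded_linear_vec_nth)
  then show ?thesis
    unfolding c
    by (intro real_polynomial_function_sum[OF finite_multi_indices] real_polynomial_function.intros(4)
        real_polynomial_function.intros(2) real_polynomial_function_prod real_polynomial_function_power) auto
qed

text \<open>On every line through a point of \<open>S\<close> the polynomial becomes one in a single real variable that
  has infinitely many roots.\<close>

lemma real_polynomial_function_eq_0:
  fixes p :: "'a::euclidean_space \<Rightarrow> real"
  assumes p: "real_polynomial_function p" and S: "open S" "S \<noteq> {}" and "\<And>x. x \<in> S \<Longrightarrow> p x = 0"
  shows "p = 0"
proof
  fix x
  obtain a where "a \<in> S" using S by blast
  have "polynomial_function (\<lambda>t::real. a + t *\<^sub>R (x - a))"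
    by (intro polynomial_function_add polynomial_function_const polynomial_function_bounded_linear
        bounded_linear_scaleR_left)
  from real_polynomial_function_compose[OF this p]
  have "real_polynomial_function (\<lambda>t. p (a + t *\<^sub>R (x - a)))" by (simp add: o_def)
  then obtain c n where c: "(\<lambda>t. p (a + t *\<^sub>R (x - a))) = (\<lambda>t. \<Sum>i\<le>n. c i * t ^ i)"
    using real_polynomial_function_iff_sum by blast
  have "open ((\<lambda>t::real. a + t *\<^sub>R (x - a)) -` S)"
    by (intro open_vimage S continuous_intros)
  moreover have "0 \<in> (\<lambda>t::real. a + t *\<^sub>R (x - a)) -` S" using \<open>a \<in> S\<close> by simp
  ultimately have "infinite ((\<lambda>t::real. a + t *\<^sub>R (x - a)) -` S)"
    using finite_imp_not_open by (metis empty_iff)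
  moreover have "(\<lambda>t::real. a + t *\<^sub>R (x - a)) -` S \<subseteq> {t. (\<Sum>i\<le>n. c i * t ^ i) = 0}"
    using assms(4) by (auto simp only: vimage_eq mem_Collect_eq fun_cong[OF c, symmetric])
  ultimately have "infinite {t. (\<Sum>i\<le>n. c i * t ^ i) = 0}" using infinite_super by blast
  then have "\<forall>i\<le>n. c i = 0" using polyfun_finite_roots by blast
  then show "p x = 0 x" using fun_cong[OF c, of 1] by simp
qed

lemma pderiv_at_eq: "(f has_derivative f') (at x) \<Longrightarrow> pderiv_at i f x = f' (axis i 1)"
  by (simp add: pderiv_at_def frechet_derivative_at[symmetric])

lemma polynomial_pderiv_at:
  assumes "real_polynomial_function p"
  shows "p differentiable at x" and "real_polynomial_function (pderiv_at i p)"
proof -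
  have "(\<forall>x. p differentiable at x) \<and> real_polynomial_function (pderiv_at i p)"
    using assms
  proof induction
    case (linear f)
    then have "pderiv_at i f = (\<lambda>_. f (axis i 1))"
      by (intro ext pderiv_at_eq bounded_linear_imp_has_derivative)
    then show ?case
      using linear by (auto simp: bounded_linear_imp_differentiable)
  next
    case (const c)
    have "pderiv_at i (\<lambda>x::real^'a. c) = (\<lambda>_. 0)"
      by (rule ext, rule pderiv_at_eq[OF has_derivative_const])
    then show ?case by auto
  next
    case (add f g)
    then have "pderiv_at i (\<lambda>x. f x + g x) x = pderiv_at i f x + pderiv_at i g x" for x
      unfolding pderiv_at_def[of i f] pderiv_at_def[of i g]
      by (intro pderiv_at_eq has_derivative_add) (simp_all add: frechet_derivative_works[symmetric])
    then have "pderiv_at i (\<lambda>x. f x + g x) = (\<lambda>x. pderiv_at i f x + pderiv_at i g x)" ..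
    then show ?case using add by auto
  next
    case (mult f g)
    then have "pderiv_at i (\<lambda>x. f x * g x) x = f x * pderiv_at i g x + pderiv_at i f x * g x" for x
      unfolding pderiv_at_def[of i f] pderiv_at_def[of i g]
      by (intro pderiv_at_eq has_derivative_mult) (simp_all add: frechet_derivative_works[symmetric])
    then have "pderiv_at i (\<lambda>x. f x * g x) = (\<lambda>x. f x * pderiv_at i g x + pderiv_at i f x * g x)" ..
    then show ?case using mult by auto
  qed
  then show "p differentiable at x" "real_polynomial_function (pderiv_at i p)" by auto
qed

lemma continuous_polynomial:
  "real_polynomial_function p \<Longrightarrow> continuous_on S p"
  by (simp add: continuous_on_polymonial_function real_polynomial_function_eq)

lemma pderiv_at_add:
  assumes "real_polynomial_function p" "real_polynomial_function q"
  shows "pderiv_at i (p + q) = pderiv_at i p + pderiv_at i q"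
proof
  show "pderiv_at i (p + q) x = (pderiv_at i p + pderiv_at i q) x" for x
    unfolding plus_fun_def pderiv_at_def[of i p] pderiv_at_def[of i q]
    using assms by (intro pderiv_at_eq has_derivative_add)
      (simp_all add: frechet_derivative_works[symmetric] polynomial_pderiv_at(1))
qed

lemma pderiv_at_scaleR:
  assumes "real_polynomial_function p"
  shows "pderiv_at i (c *\<^sub>R p) = c *\<^sub>R pderiv_at i p"
proof
  show "pderiv_at i (c *\<^sub>R p) x = (c *\<^sub>R pderiv_at i p) x" for x
    unfolding scaleR_fun_def pderiv_at_def[of i p]
    using assms by (intro pderiv_at_eq has_derivative_scaleR_right)
      (simp_all add: frechet_derivative_works[symmetric] polynomial_pderiv_at(1))
qed

lemma grad_add:
  "real_polynomial_function p \<Longrightarrow> real_polynomial_function q \<Longrightarrow> grad (p + q) x = grad p x + grad q x"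
  by (simp add: grad_def vec_eq_iff pderiv_at_add)

lemma grad_scaleR: "real_polynomial_function p \<Longrightarrow> grad (c *\<^sub>R p) x = c *\<^sub>R grad p x"
  by (simp add: grad_def vec_eq_iff pderiv_at_scaleR)

lemma laplacian_add:
  "real_polynomial_function p \<Longrightarrow> real_polynomial_function q \<Longrightarrow>
    laplacian (p + q) x = laplacian p x + laplacian q x"
  by (simp add: laplacian_def pderiv_at_add polynomial_pderiv_at(2) sum.distrib)

lemma laplacian_scaleR:
  "real_polynomial_function p \<Longrightarrow> laplacian (c *\<^sub>R p) x = c * laplacian p x"
  by (simp add: laplacian_def pderiv_at_scaleR polynomial_pderiv_at(2) sum_distrib_left)

lemma continuous_grad: "real_polynomial_function p \<Longrightarrow> continuous_on S (grad p)"
  unfolding grad_def by (intro continuous_intros continuous_polynomial polynomial_pderiv_at(2))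

lemma continuous_laplacian: "real_polynomial_function p \<Longrightarrow> continuous_on S (laplacian p)"
  unfolding laplacian_def by (intro continuous_intros continuous_polynomial polynomial_pderiv_at(2))

section \<open>Square integrable functions\<close>

lemma L2_product_integrable:
  assumes "L2 \<mu> g" "L2 \<mu> h" shows "integrable \<mu> (\<lambda>x. g x * h x)"
proof (rule Bochner_Integration.integrable_bound)
  show "integrable \<mu> (\<lambda>x. (g x)\<^sup>2 + (h x)\<^sup>2)"
    using assms by (auto simp: L2_def)
  show "(\<lambda>x. g x * h x) \<in> borel_measurable \<mu>"
    using assms by (auto simp: L2_def)
  have "\<bar>g x * h x\<bar> \<le> (g x)\<^sup>2 + (h x)\<^sup>2" for x
  proof -
    have "2 * \<bar>g x * h x\<bar> \<le> (g x)\<^sup>2 + (h x)\<^sup>2"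
      using sum_squares_bound[of "\<bar>g x\<bar>" "\<bar>h x\<bar>"] by (simp add: abs_mult)
    then show ?thesis by linarith
  qed
  then show "AE x in \<mu>. norm (g x * h x) \<le> norm ((g x)\<^sup>2 + (h x)\<^sup>2)"
    by (auto intro!: AE_I2)
qed

lemma L2_times: "L2 \<mu> g \<Longrightarrow> L2 \<mu> (\<lambda>x. c * g x)"
  by (auto simp: L2_def power_mult_distrib)

lemma L2_add:
  assumes "L2 \<mu> g" "L2 \<mu> h" shows "L2 \<mu> (\<lambda>x. g x + h x)"
proof -
  have "(\<lambda>x. (g x + h x)\<^sup>2) = (\<lambda>x. (g x)\<^sup>2 + 2 * (g x * h x) + (h x)\<^sup>2)"
    by (simp add: power2_eq_square algebra_simps)
  then show ?thesis
    using assms L2_product_integrable[OF assms] by (auto simp: L2_def)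
qed

lemma L2_bounded:
  assumes "finite_measure \<mu>" "g \<in> borel_measurable \<mu>" "\<And>x. x \<in> space \<mu> \<Longrightarrow> \<bar>g x\<bar> \<le> B"
  shows "L2 \<mu> g"
proof -
  have "\<bar>(g x)\<^sup>2\<bar> \<le> B\<^sup>2" if "x \<in> space \<mu>" for x
    using power_mono[OF assms(3)[OF that], of 2] by simp
  then show ?thesis
    using assms(1,2) unfolding L2_def
    by (auto intro!: finite_measure.integrable_const_bound[where B = "B\<^sup>2"] AE_I2)
qed

lemma bilinear_form_on_integral_product:
  assumes "\<And>p. p \<in> V \<Longrightarrow> L2 \<mu> p"
  shows "bilinear_form_on V (\<lambda>p q. \<integral>x. p x * q x \<partial>\<mu>)"
  using assms
  by (intro bilinear_form_onI linear_form_on_integral)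
    (auto simp: algebra_simps intro: L2_product_integrable)

text \<open>Both \<open>L\<^sup>2\<close> projections and the weak Laplacian are defined through such a \<open>p\<close>, for different
  functionals \<open>L\<close>.\<close>

lemma L2_ex1_representer:
  assumes "subspace V" "finite C" "V \<subseteq> span C"
    and "\<And>p. p \<in> V \<Longrightarrow> L2 \<mu> p" and "\<And>p. p \<in> V \<Longrightarrow> (\<integral>x. (p x)\<^sup>2 \<partial>\<mu>) = 0 \<Longrightarrow> p = 0"
    and "linear_form_on V L"
  shows "\<exists>!p. p \<in> V \<and> (\<forall>q\<in>V. (\<integral>x. p x * q x \<partial>\<mu>) = L q)"
  by (rule ex1_representer[OF assms(1-3) bilinear_form_on_integral_product[OF assms(4)] _ assms(6)])
    (use assms(5) in \<open>auto simp: power2_eq_square\<close>)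

lemma L2_proj_in:
  assumes V: "subspace V" "finite C" "V \<subseteq> span C"
    and L2: "\<And>p. p \<in> V \<Longrightarrow> L2 \<mu> p" and definite: "\<And>p. p \<in> V \<Longrightarrow> (\<integral>x. (p x)\<^sup>2 \<partial>\<mu>) = 0 \<Longrightarrow> p = 0"
    and g: "L2 \<mu> g"
  shows "L2_proj \<mu> V g \<in> V"
proof -
  have "linear_form_on V (\<lambda>q. \<integral>x. g x * q x \<partial>\<mu>)"
    using L2 g by (intro linear_form_on_integral) (auto simp: algebra_simps intro: L2_product_integrable)
  from theI'[OF L2_ex1_representer[OF V L2 definite this]]
  show ?thesis unfolding L2_proj_def by blast
qed

section \<open>Cells\<close>

lemma polytopal_compact: "polytopal m S \<Longrightarrow> compact S"
  unfolding polytopal_def by (blast intro: compact_Union polytope_imp_compact)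

lemma polytopal_nonempty: "polytopal m S \<Longrightarrow> m \<ge> 0 \<Longrightarrow> S \<noteq> {}"
  by (auto simp: polytopal_def)

lemma polytopal_rel_interior_nonempty:
  "polytopal m S \<Longrightarrow> m \<ge> 0 \<Longrightarrow> rel_interior S \<noteq> {}"
  by (metis closure_empty polytopal_def polytopal_nonempty)

lemma polytopal_interior_nonempty:
  fixes T :: "(real^'n) set"
  assumes "polytopal (int CARD('n)) T" shows "interior T \<noteq> {}"
proof -
  have "aff_dim T = int CARD('n)" using assms by (simp add: polytopal_def)
  then have "affine hull T = UNIV" by (simp flip: aff_dim_eq_full)
  then have "rel_interior T = interior T" by (rule rel_interior_interior)
  then show ?thesis using polytopal_rel_interior_nonempty[OF assms] by simp
qed

lemma polytopal_negligible_frontier: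
  fixes S :: "(real^'n) set"
  assumes "polytopal m S" shows "negligible (frontier S)"
proof -
  obtain F where F: "finite F" "\<forall>P\<in>F. polytope P" "S = \<Union>F"
    using assms by (auto simp: polytopal_def)
  have "negligible (\<Union>(frontier ` F))"
    using F by (intro negligible_Union) (auto intro: negligible_convex_frontier polytope_imp_convex)
  moreover have "frontier S \<subseteq> \<Union>(frontier ` F)"
    using frontier_Union_subset[OF F(1)] F(3) by simp
  ultimately show ?thesis by (rule negligible_subset)
qed

lemma L2_cell_continuous:
  fixes p :: "real^'n \<Rightarrow> real"
  assumes "compact T" "continuous_on T p" shows "L2 (lebesgue_on T) p"
proof -
  have T: "T \<in> lmeasurable" using assms(1) by (rule lmeasurable_compact)
  have "compact (p ` T)" using assms by (simp add: compact_continuous_image)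
  then obtain B where "\<And>y. y \<in> p ` T \<Longrightarrow> norm y \<le> B"
    using compact_imp_bounded bounded_iff by metis
  then show ?thesis
    using T assms(2)
    by (intro L2_bounded[of _ _ B] finite_measure_lebesgue_on continuous_imp_measurable_on_sets_lebesgue)
      auto
qed

lemma L2_cell_poly_space:
  "compact T \<Longrightarrow> p \<in> poly_space k \<Longrightarrow> L2 (lebesgue_on T) p"
  by (intro L2_cell_continuous continuous_polynomial real_polynomial_function_poly_space)

text \<open>A polynomial with vanishing \<open>L\<^sup>2(T)\<close> norm is zero almost everywhere on \<open>T\<close>, by continuity on the
  whole interior of \<open>T\<close>, and hence as a polynomial.\<close>

lemma poly_space_definite_on_cell:
  fixes T :: "(real^'n) set"
  assumes T: "polytopal (int CARD('n)) T" and p: "p \<in> poly_space k"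
    and 0: "(\<integral>x. (p x)\<^sup>2 \<partial>lebesgue_on T) = 0"
  shows "p = 0"
proof -
  have poly: "real_polynomial_function p" using p by (rule real_polynomial_function_poly_space)
  have cT: "compact T" using T by (rule polytopal_compact)
  then have Tl: "T \<in> sets lebesgue" by (simp add: lmeasurable_compact fmeasurableD)
  have "integrable (lebesgue_on T) (\<lambda>x. (p x)\<^sup>2)"
    using L2_cell_poly_space[OF cT p] by (simp add: L2_def)
  then have "AE x in lebesgue_on T. (p x)\<^sup>2 = 0"
    using 0 by (simp add: integral_nonneg_eq_0_iff_AE)
  then have "AE x in lebesgue. x \<in> T \<longrightarrow> p x = 0"
    using Tl by (simp add: AE_restrict_space_iff)
  then have "{x. \<not> (x \<in> T \<longrightarrow> p x = 0)} \<in> null_sets lebesgue"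
    by (simp only: completion.AE_iff_null_sets space_completion space_lborel space_borel UNIV_I simp_thms)
  then have "negligible {x. \<not> (x \<in> T \<longrightarrow> p x = 0)}" by (simp add: negligible_iff_null_sets)
  then have "negligible (interior T \<inter> {x. p x \<noteq> 0})"
    by (rule negligible_subset) (use interior_subset in auto)
  moreover have "open {x. p x \<noteq> 0}"
    by (intro open_Collect_neq continuous_polynomial poly continuous_on_const)
  ultimately have "interior T \<inter> {x. p x \<noteq> 0} = {}"
    using open_not_negligible open_Int open_interior by blast
  then show ?thesis
    by (intro real_polynomial_function_eq_0[OF poly, of "interior T"])
      (use polytopal_interior_nonempty[OF T] in auto)
qed

lemma borel_measurable_lebesgue_AE:
  fixes f g :: "'a::euclidean_space \<Rightarrow> real"
  assumes f: "f \<in> borel_measurable lebesgue" and "AE x in lebesgue. f x = g x"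
  shows "g \<in> borel_measurable lebesgue"
proof (rule measurableI)
  fix A :: "real set" assume "A \<in> sets borel"
  then have "f -` A \<inter> space lebesgue \<in> sets lebesgue" using f by (rule measurable_sets[rotated])
  then show "g -` A \<inter> space lebesgue \<in> sets lebesgue"
    by (rule completion.in_sets_AE[rotated]) (use assms(2) in auto)
qed simp

text \<open>A cell may touch the boundary of \<open>\<Omega>\<close>, where functions in \<open>L\<^sup>2(\<Omega>)\<close> are not controlled; but
  \<open>T - \<Omega>\<close> lies in the frontier of a finite union of polytopes and is therefore a null set.\<close>

lemma L2_restrict_cell:
  fixes \<Omega> T :: "(real^'n) set"
  assumes \<Omega>: "polytopal_domain \<Omega>" and T: "compact T" "T \<subseteq> closure \<Omega>"
    and g: "L2 (lebesgue_on \<Omega>) g"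
  shows "L2 (lebesgue_on T) g"
proof -
  have "\<Omega> = interior (closure \<Omega>)" using \<Omega> by (simp add: polytopal_domain_def)
  then have "open \<Omega>" by (rule ssubst) (rule open_interior)
  then have \<Omega>l: "\<Omega> \<in> sets lebesgue" by (simp add: borel_open sets_completionI_sets)
  have Tl: "T \<in> sets lebesgue" using T(1) by (simp add: lmeasurable_compact fmeasurableD)
  have "closure \<Omega> - \<Omega> \<subseteq> frontier (closure \<Omega>)"
    using \<open>\<Omega> = interior (closure \<Omega>)\<close> unfolding frontier_def by (metis Diff_mono closed_closure closure_closed order_refl)
  moreover have "negligible (frontier (closure \<Omega>))"
    using \<Omega> polytopal_negligible_frontier by (auto simp: polytopal_domain_def)
  ultimately have N: "negligible (T - \<Omega>)"
    using T(2) by (meson Diff_mono negligible_subset order_refl)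
  \<comment> \<open>Cutting \<open>g\<close> off outside \<open>T \<inter> \<Omega>\<close> or outside \<open>T\<close> differs only on the null set \<open>T - \<Omega>\<close>.\<close>
  have AE: "AE x in lebesgue. indicator (T \<inter> \<Omega>) x *\<^sub>R g x = indicator T x *\<^sub>R g x"
    "AE x in lebesgue. indicator (T \<inter> \<Omega>) x *\<^sub>R (g x)\<^sup>2 = indicator T x *\<^sub>R (g x)\<^sup>2"
    by (rule AE_I'[OF N[unfolded negligible_iff_null_sets]]; auto simp: indicator_def)+
  have "g \<in> borel_measurable (lebesgue_on (T \<inter> \<Omega>))"
    by (rule measurable_restrict_mono[where A = \<Omega>]) (use g in \<open>auto simp: L2_def\<close>)
  then have "(\<lambda>x. indicator (T \<inter> \<Omega>) x *\<^sub>R g x) \<in> borel_measurable lebesgue"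
    using Tl \<Omega>l by (subst (asm) borel_measurable_restrict_space_iff) auto
  then have "(\<lambda>x. indicator T x *\<^sub>R g x) \<in> borel_measurable lebesgue"
    using AE(1) by (rule borel_measurable_lebesgue_AE)
  then have meas: "g \<in> borel_measurable (lebesgue_on T)"
    using Tl by (subst borel_measurable_restrict_space_iff) auto
  have "integrable lebesgue (\<lambda>x. indicator \<Omega> x *\<^sub>R (g x)\<^sup>2)"
    using g \<Omega>l by (subst (asm) L2_def) (simp add: integrable_restrict_space)
  from integrable_mult_indicator[OF Tl this]
  have "integrable lebesgue (\<lambda>x. indicator (T \<inter> \<Omega>) x *\<^sub>R (g x)\<^sup>2)"
    by (simp add: indicator_inter_arith mult.assoc)
  moreover have "(\<lambda>x. indicator T x *\<^sub>R (g x)\<^sup>2) \<in> borel_measurable lebesgue"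
    using meas Tl by (subst borel_measurable_restrict_space_iff[symmetric]) auto
  ultimately have "integrable lebesgue (\<lambda>x. indicator T x *\<^sub>R (g x)\<^sup>2)"
    using AE(2) by (rule integrable_cong_AE_imp)
  then have "integrable (lebesgue_on T) (\<lambda>x. (g x)\<^sup>2)"
    using Tl by (simp add: integrable_restrict_space)
  with meas show ?thesis by (simp add: L2_def)
qed

section \<open>Faces\<close>

lemma sets_surface_measure [measurable_cong, simp]: "sets (surface_measure \<nu> e) = sets borel"
  by (simp add: surface_measure_def Let_def)

lemma space_surface_measure [simp]: "space (surface_measure \<nu> e) = UNIV"
  by (simp add: surface_measure_def Let_def)

context
  fixes \<nu> :: "real^'n" and e :: "(real^'n) set"
  assumes e: "polytopal (int CARD('n) - 1) e" and \<nu>: "norm \<nu> = 1"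
    and normal: "\<forall>x\<in>e. \<forall>y\<in>e. \<nu> \<bullet> (x - y) = 0"
begin

private lemma rel_interior_nonempty: "rel_interior e \<noteq> {}"
proof -
  have "CARD('n) > 0" by (rule zero_less_card_finite)
  then have "int CARD('n) - 1 \<ge> 0" by linarith
  then show ?thesis by (rule polytopal_rel_interior_nonempty[OF e])
qed

private lemma nonempty: "e \<noteq> {}"
  using rel_interior_nonempty by auto

private lemma compact: "compact e"
  using e by (rule polytopal_compact)

text \<open>The hull lies in this hyperplane and has the same dimension.\<close>

lemma affine_hull_face:
  assumes "a \<in> e" shows "affine hull e = {x. \<nu> \<bullet> x = \<nu> \<bullet> a}"
proof (rule affine_dim_equal)
  show "affine hull e \<subseteq> {x. \<nu> \<bullet> x = \<nu> \<bullet> a}"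
  proof (rule hull_minimal)
    show "e \<subseteq> {x. \<nu> \<bullet> x = \<nu> \<bullet> a}"
    proof
      fix x assume "x \<in> e"
      then have "\<nu> \<bullet> (x - a) = 0" using normal assms by blast
      then show "x \<in> {x. \<nu> \<bullet> x = \<nu> \<bullet> a}" by (simp add: inner_diff_right)
    qed
  qed (rule affine_hyperplane)
  have "aff_dim e = int CARD('n) - 1" using e by (simp add: polytopal_def)
  moreover have "\<nu> \<noteq> 0" using \<nu> by auto
  ultimately show "aff_dim (affine hull e) = aff_dim {x. \<nu> \<bullet> x = \<nu> \<bullet> a}"
    by (simp add: aff_dim_hyperplane of_nat_diff)
qed (use nonempty in \<open>auto simp: affine_hyperplane\<close>)

text \<open>The component of \<open>n\<close> orthogonal to \<open>\<nu>\<close> is a direction of the hyperplane of \<open>e\<close>, hence orthogonal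
  to \<open>n\<close>; this forces \<open>(\<nu> \<bullet> n)\<^sup>2 = 1\<close>.\<close>

lemma unit_normal_unique_up_to_sign:
  assumes n: "norm n = 1" "\<forall>x\<in>e. \<forall>y\<in>e. n \<bullet> (x - y) = 0"
  shows "n = \<nu> \<or> n = - \<nu>"
proof -
  obtain a where a: "a \<in> e" using nonempty by blast
  have "affine hull e \<subseteq> {x. n \<bullet> x = n \<bullet> a}"
  proof (rule hull_minimal)
    show "e \<subseteq> {x. n \<bullet> x = n \<bullet> a}"
    proof
      fix x assume "x \<in> e"
      then have "n \<bullet> (x - a) = 0" using n(2) a by blast
      then show "x \<in> {x. n \<bullet> x = n \<bullet> a}" by (simp add: inner_diff_right)
    qed
  qed (rule affine_hyperplane)
  moreover have "a + (n - (\<nu> \<bullet> n) *\<^sub>R \<nu>) \<in> affine hull e"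
    using \<nu> by (simp add: affine_hull_face[OF a] inner_add_right inner_diff_right dot_square_norm)
  ultimately have "n \<bullet> (a + (n - (\<nu> \<bullet> n) *\<^sub>R \<nu>)) = n \<bullet> a" by blast
  then have "(\<nu> \<bullet> n)\<^sup>2 = 1"
    using n(1) by (simp add: inner_add_right inner_diff_right dot_square_norm inner_commute power2_eq_square)
  then consider "\<nu> \<bullet> n = 1" | "\<nu> \<bullet> n = -1" by (auto simp: power2_eq_1_iff)
  then show ?thesis
  proof cases
    case 1
    then have "(norm (n - \<nu>))\<^sup>2 = 0"
      using n(1) \<nu> by (simp add: power2_norm_eq_inner inner_diff_left inner_diff_right inner_commute norm_eq_1)
    then show ?thesis by simp
  next
    case 2
    then have "(norm (n + \<nu>))\<^sup>2 = 0"
      using n(1) \<nu> by (simp add: power2_norm_eq_inner inner_add_left inner_add_right inner_commute norm_eq_1)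
    then show ?thesis by (simp add: add_eq_0_iff2)
  qed
qed

text \<open>Of the two unit normals only one can point out of \<open>T\<close>, since a short step along the other one
  leads into the interior of \<open>T\<close>.\<close>

lemma outward_normal_eq:
  assumes "is_outward_normal T e n"
  shows "outward_normal T e = n"
  unfolding outward_normal_def
proof (rule the_equality[of "is_outward_normal T e", OF assms])
  fix n' assume n': "is_outward_normal T e n'"
  obtain x where x: "x \<in> rel_interior e"
    using rel_interior_nonempty by blast
  obtain \<delta> where \<delta>: "\<delta> > 0" "\<And>t. 0 < t \<Longrightarrow> t < \<delta> \<Longrightarrow> x - t *\<^sub>R n' \<in> interior T"
    using n' x unfolding is_outward_normal_def by meson
  obtain \<epsilon> where \<epsilon>: "\<epsilon> > 0" "\<And>t. 0 < t \<Longrightarrow> t < \<epsilon> \<Longrightarrow> x + t *\<^sub>R n \<notin> T"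
    using assms x unfolding is_outward_normal_def by meson
  have "n' \<noteq> - n"
  proof
    assume "n' = - n"
    moreover obtain t where "0 < t" "t < \<delta>" "t < \<epsilon>"
      using \<delta>(1) \<epsilon>(1) field_lbound_gt_zero by blast
    ultimately show False using \<delta>(2)[of t] \<epsilon>(2)[of t] interior_subset by auto
  qed
  then show "n' = n"
    using unit_normal_unique_up_to_sign[of n] unit_normal_unique_up_to_sign[of n'] assms n'
    by (auto simp: is_outward_normal_def)
qed

text \<open>This nonzero factor is what allows the normal component \<open>v\<^sub>n\<close> to be recovered from
  \<open>v\<^sub>n n\<^sub>e \<bullet> n\<close>.\<close>

lemma normal_inner_outward_normal:
  assumes "\<exists>n. is_outward_normal T e n"
  shows "\<nu> \<bullet> outward_normal T e \<noteq> 0"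
proof -
  obtain n where n: "is_outward_normal T e n" using assms by blast
  then have "n = \<nu> \<or> n = - \<nu>"
    by (intro unit_normal_unique_up_to_sign) (auto simp: is_outward_normal_def)
  then show ?thesis using \<nu> outward_normal_eq[OF n] by auto
qed

private abbreviation "prism \<equiv> {x + s *\<^sub>R \<nu> | x s. x \<in> e \<and> 0 \<le> s \<and> s \<le> 1}"

private lemma compact_prism: "compact prism"
proof -
  have "prism = (\<lambda>(x, s). x + s *\<^sub>R \<nu>) ` (e \<times> {0..1})"
    by (force simp: image_def)
  moreover have "compact ((\<lambda>(x, s). x + s *\<^sub>R \<nu>) ` (e \<times> {0..1::real}))"
    unfolding split_def
    by (intro compact_continuous_image compact_Times compact compact_Icc continuous_intros)
  ultimately show ?thesis by metis
qed

lemma finite_surface_measure: "finite_measure (surface_measure \<nu> e)"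
proof -
  have "prism \<in> sets lborel" using compact_prism by (simp add: borel_compact)
  then have "finite_measure (restrict_space lborel prism)"
    using emeasure_compact_finite[OF compact_prism]
    by (intro finite_measureI) (simp add: space_restrict_space emeasure_restrict_space)
  then show ?thesis
    unfolding surface_measure_def Let_def
    by (intro finite_measure.finite_measure_distr measurable_restrict_space1) measurable
qed

text \<open>The surface measure of a set is the volume of the prism of height 1 over it.  If \<open>p\<close> did not
  vanish at a relative interior point \<open>z\<close> of \<open>e\<close>, the prism over the set of nonzeros of \<open>p\<close> in \<open>e\<close>
  would contain a ball around \<open>z + \<nu> / 2\<close>, which has positive volume.  The zeros in the relative
  interior extend to \<open>e\<close> by continuity.\<close>

lemma surface_measure_continuous_zero:
  fixes p :: "real^'n \<Rightarrow> real"
  assumes p: "continuous_on UNIV p"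
    and AE: "AE x in surface_measure \<nu> e. x \<in> e \<longrightarrow> p x = 0" and x: "x \<in> e"
  shows "p x = 0"
proof -
  define a where "a = (SOME a. a \<in> e)"
  have a: "a \<in> e" unfolding a_def using nonempty some_in_eq by blast
  define proj where "proj y = y - (\<nu> \<bullet> (y - a)) *\<^sub>R \<nu>" for y
  have e_borel: "e \<in> sets borel" using compact by (simp add: borel_compact)
  have prism_borel: "prism \<in> sets borel" using compact_prism by (simp add: borel_compact)
  have p_borel: "p \<in> borel_measurable borel" using p by (rule borel_measurable_continuous_onI)
  have proj_borel: "proj \<in> borel_measurable (restrict_space lborel prism)"
    unfolding proj_def by (intro measurable_restrict_space1) measurable
  have "AE y in restrict_space lborel prism. proj y \<in> e \<longrightarrow> p (proj y) = 0"
    using AE unfolding surface_measure_def Let_def a_def[symmetric] proj_def[symmetric]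
    by (subst (asm) AE_distr_iff[OF proj_borel]) (use e_borel p_borel in measurable)
  then have AE': "AE y in lborel. y \<in> prism \<longrightarrow> proj y \<in> e \<longrightarrow> p (proj y) = 0"
    using prism_borel by (subst (asm) AE_restrict_space_iff) auto
  have zero: "p z = 0" if z: "z \<in> rel_interior e" for z
  proof (rule ccontr)
    assume "p z \<noteq> 0"
    have "open {y. p y \<noteq> 0}" by (intro open_Collect_neq p continuous_on_const)
    then obtain \<delta>1 where \<delta>1: "\<delta>1 > 0" "ball z \<delta>1 \<subseteq> {y. p y \<noteq> 0}"
      using \<open>p z \<noteq> 0\<close> openE by blast
    obtain \<delta>2 where \<delta>2: "\<delta>2 > 0" "ball z \<delta>2 \<inter> affine hull e \<subseteq> e" and "z \<in> e"
      using z by (auto simp: mem_rel_interior_ball)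
    \<comment> \<open>The bound \<open>1/2\<close> keeps the ball between the two bases of the prism; \<open>\<delta>1\<close> and \<open>\<delta>2\<close> make its
      projection stay among the nonzeros of \<open>p\<close> and inside \<open>e\<close>.\<close>
    define \<delta> where "\<delta> = min (1/2) (min \<delta>1 \<delta>2)"
    have "\<delta> > 0" using \<delta>1(1) \<delta>2(1) by (simp add: \<delta>_def)
    define c where "c = z + (1/2) *\<^sub>R \<nu>"
    have "\<nu> \<bullet> (z - a) = 0" using normal \<open>z \<in> e\<close> a by blast
    then have z\<nu>: "\<nu> \<bullet> z = \<nu> \<bullet> a" by (simp add: inner_diff_right)
    have \<nu>\<nu>: "\<nu> \<bullet> \<nu> = 1" using \<nu> by (simp add: norm_eq_1)
    have bad: "y \<in> prism \<and> proj y \<in> e \<and> p (proj y) \<noteq> 0" if y: "y \<in> ball c \<delta>" for y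
    proof -
      define w where "w = y - c"
      define s where "s = \<nu> \<bullet> (y - a)"
      have w: "norm w < \<delta>" using y by (simp add: w_def dist_norm norm_minus_commute)
      have y_eq: "y = z + (1/2) *\<^sub>R \<nu> + w" by (simp add: w_def c_def)
      have s_eq: "s = 1/2 + \<nu> \<bullet> w"
        using z\<nu> \<nu>\<nu> by (simp add: s_def y_eq inner_add_right inner_diff_right)
      have "\<bar>\<nu> \<bullet> w\<bar> < 1/2"
        using Cauchy_Schwarz_ineq2[of \<nu> w] \<nu> w by (simp add: \<delta>_def)
      then have s: "0 \<le> s" "s \<le> 1" using s_eq by auto
      have proj_eq: "proj y = z + (w - (\<nu> \<bullet> w) *\<^sub>R \<nu>)"
        by (simp add: proj_def s_def[symmetric] s_eq) (simp add: y_eq algebra_simps)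
      have "(norm (w - (\<nu> \<bullet> w) *\<^sub>R \<nu>))\<^sup>2 = (norm w)\<^sup>2 - (\<nu> \<bullet> w)\<^sup>2"
        unfolding power2_norm_eq_inner power2_eq_square[of "\<nu> \<bullet> w"]
        using \<nu>\<nu> by (simp add: inner_diff_left inner_diff_right inner_commute)
      also have "\<dots> \<le> (norm w)\<^sup>2" by simp
      finally have "norm (w - (\<nu> \<bullet> w) *\<^sub>R \<nu>) \<le> norm w" by simp
      moreover have "dist z (proj y) = norm (w - (\<nu> \<bullet> w) *\<^sub>R \<nu>)"
        by (simp add: proj_eq dist_norm norm_minus_commute)
      ultimately have pb: "proj y \<in> ball z \<delta>" using w by simp
      have "\<nu> \<bullet> proj y = \<nu> \<bullet> a"
        using z\<nu> \<nu>\<nu> by (simp add: proj_eq inner_add_right inner_diff_right)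
      then have "proj y \<in> affine hull e" by (simp add: affine_hull_face[OF a])
      then have pe: "proj y \<in> e" using pb \<delta>2(2) by (auto simp: \<delta>_def)
      have "y = proj y + s *\<^sub>R \<nu>" by (simp add: proj_def s_def)
      then have "y \<in> prism" using pe s by blast
      then show ?thesis using pe pb \<delta>1(2) by (auto simp: \<delta>_def)
    qed
    have "AE y in lborel. y \<notin> ball c \<delta>"
      using AE' by eventually_elim (use bad in blast)
    then have "ball c \<delta> \<in> null_sets lborel"
      by (subst AE_iff_null_sets) auto
    then have "negligible (ball c \<delta>)"
      by (simp add: negligible_iff_null_sets null_sets_completionI)
    then show False using open_not_negligible[OF open_ball, of c \<delta>] \<open>\<delta> > 0\<close> by simp
  qed
  have "closed {y. p y = 0}" by (intro closed_Collect_eq p continuous_on_const)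
  moreover have "rel_interior e \<subseteq> {y. p y = 0}" using zero by blast
  ultimately have "closure (rel_interior e) \<subseteq> {y. p y = 0}" by (rule closure_minimal[rotated])
  then show ?thesis using e x by (auto simp: polytopal_def)
qed

lemma L2_face_continuous:
  fixes p :: "real^'n \<Rightarrow> real"
  assumes p: "continuous_on UNIV p"
  shows "L2 (surface_measure \<nu> e) (\<lambda>x. if x \<in> e then p x else 0)"
proof -
  have "compact (p ` e)"
    using p compact by (intro compact_continuous_image) (auto intro: continuous_on_subset)
  then obtain B where B: "\<And>y. y \<in> p ` e \<Longrightarrow> norm y \<le> B"
    using compact_imp_bounded bounded_iff by metis
  have e_borel: "e \<in> sets borel" using compact by (simp add: borel_compact)
  have p_borel: "p \<in> borel_measurable borel" using p by (rule borel_measurable_continuous_onI)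
  have meas: "(\<lambda>x. if x \<in> e then p x else 0) \<in> borel_measurable (surface_measure \<nu> e)"
    using e_borel p_borel by measurable
  have "\<bar>if x \<in> e then p x else 0\<bar> \<le> max B 0" for x
    using B[of "p x"] by auto
  then show ?thesis by (intro L2_bounded[of _ _ "max B 0"] finite_surface_measure meas)
qed

lemma L2_face_poly_space:
  assumes "p \<in> poly_space_on k e" shows "L2 (surface_measure \<nu> e) p"
  using assms
  by (auto simp: poly_space_on_def
      intro!: L2_face_continuous continuous_polynomial real_polynomial_function_poly_space)

text \<open>A polynomial on \<open>e\<close> is zero off \<open>e\<close>, so only the values of \<open>c\<close> on the compact set \<open>e\<close> matter, although
  \<open>surface_measure\<close> lives on the whole space.\<close>

lemma face_integrable:
  assumes p: "p \<in> poly_space_on k e" and c: "continuous_on UNIV c"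
  shows "integrable (surface_measure \<nu> e) (\<lambda>x. p x * c x)"
proof -
  have "(\<lambda>x. p x * c x) = (\<lambda>x. p x * (if x \<in> e then c x else 0))"
    using p by (auto simp: poly_space_on_def)
  then show ?thesis
    using L2_product_integrable[OF L2_face_poly_space[OF p] L2_face_continuous[OF c]] by simp
qed

lemma poly_space_on_definite:
  assumes p: "p \<in> poly_space_on k e" and 0: "(\<integral>x. (p x)\<^sup>2 \<partial>surface_measure \<nu> e) = 0"
  shows "p = 0"
proof -
  obtain q where q: "q \<in> poly_space k" "p = (\<lambda>x. if x \<in> e then q x else 0)"
    using p by (auto simp: poly_space_on_def)
  have "integrable (surface_measure \<nu> e) (\<lambda>x. (p x)\<^sup>2)"
    using L2_face_poly_space[OF p] by (simp add: L2_def)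
  then have "AE x in surface_measure \<nu> e. (p x)\<^sup>2 = 0"
    using 0 by (simp add: integral_nonneg_eq_0_iff_AE)
  then have "AE x in surface_measure \<nu> e. x \<in> e \<longrightarrow> q x = 0"
    by eventually_elim (simp add: q(2) split: if_splits)
  then have "q x = 0" if "x \<in> e" for x
    using surface_measure_continuous_zero[OF continuous_polynomial] q(1) that
      real_polynomial_function_poly_space by blast
  then show ?thesis by (auto simp: q(2))
qed

end

section \<open>Finite element spaces\<close>

definition restrict_zero :: "'a set \<Rightarrow> ('a \<Rightarrow> real) \<Rightarrow> 'a \<Rightarrow> real" where
  "restrict_zero e p = (\<lambda>x. if x \<in> e then p x else 0)"

lemma linear_restrict_zero: "linear (restrict_zero e)"
  by (rule linearI) (auto simp: restrict_zero_def fun_eq_iff)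

lemma poly_space_on_eq_image: "poly_space_on k e = restrict_zero e ` poly_space k"
  by (auto simp: poly_space_on_def restrict_zero_def)

lemma subspace_poly_space_on: "subspace (poly_space_on k e)"
  unfolding poly_space_on_eq_image by (intro linear_subspace_image linear_restrict_zero subspace_poly_space)

lemma poly_space_on_subset_span: "poly_space_on k e \<subseteq> span (restrict_zero e ` monomials k)"
  unfolding poly_space_on_eq_image linear_span_image[OF linear_restrict_zero]
  by (intro image_mono poly_space_subset_span)

lemma weak_fun_components [simp]:
  "w0 (u + v) = w0 u + w0 v" "wb (u + v) = wb u + wb v" "wn (u + v) = wn u + wn v"
  "w0 (c *\<^sub>R v) = c *\<^sub>R w0 v" "wb (c *\<^sub>R v) = c *\<^sub>R wb v" "wn (c *\<^sub>R v) = c *\<^sub>R wn v"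
  "w0 0 = 0" "wb 0 = 0" "wn 0 = 0"
  by (simp_all add: plus_weak_fun_def scaleR_weak_fun_def zero_weak_fun_def fun_eq_iff)

lemma linear_weak_fun_components: "linear w0" "linear wb" "linear wn"
  by (auto intro: linearI)

definition cell_part :: "'a set \<Rightarrow> ('a \<Rightarrow> real) \<Rightarrow> 'a weak_fun" where
  "cell_part T p = Weak (0(T := p)) 0 0"

definition trace_part :: "'a set \<Rightarrow> ('a \<Rightarrow> real) \<Rightarrow> 'a weak_fun" where
  "trace_part e p = Weak 0 (0(e := p)) 0"

definition normal_part :: "'a set \<Rightarrow> ('a \<Rightarrow> real) \<Rightarrow> 'a weak_fun" where
  "normal_part e p = Weak 0 0 (0(e := p))"

lemma linear_parts: "linear (cell_part T)" "linear (trace_part e)" "linear (normal_part e)"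
  by (rule linearI; rule weak_fun.expand; auto simp: cell_part_def trace_part_def normal_part_def fun_eq_iff)+

lemma sum_point_masses:
  fixes g :: "'b \<Rightarrow> 'c::comm_monoid_add"
  assumes "finite A" "\<And>a. a \<notin> A \<Longrightarrow> g a = 0"
  shows "(\<Sum>a\<in>A. 0(a := g a)) = g"
proof
  fix b
  have "(\<Sum>a\<in>A. (0(a := g a)) b) = (\<Sum>a\<in>A. if a = b then g a else 0)"
    by (rule sum.cong) auto
  also have "\<dots> = g b" using assms by (simp add: sum.delta)
  finally show "(\<Sum>a\<in>A. 0(a := g a)) b = g b" by (simp add: sum_fun_eq)
qed

text \<open>Since a function in \<open>V\<^sub>h\<close> vanishes at all sets that are not cells or faces, it is the finite sum of
  its parts.\<close>

lemma Vh_decomposition: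
  assumes "finite (cells M)" "finite (faces M)" "v \<in> Vh M k"
  shows "v = (\<Sum>T\<in>cells M. cell_part T (w0 v T)) + (\<Sum>e\<in>faces M. trace_part e (wb v e))
    + (\<Sum>e\<in>faces M. normal_part e (wn v e))" (is "v = ?u")
proof (rule weak_fun.expand)
  have 0: "T \<notin> cells M \<Longrightarrow> w0 v T = 0" "e \<notin> faces M \<Longrightarrow> wb v e = 0" "e \<notin> faces M \<Longrightarrow> wn v e = 0" for T e
    using assms(3) by (auto simp: Vh_def fun_eq_iff)
  note sums = sum_point_masses[OF assms(1), of "w0 v"] sum_point_masses[OF assms(2), of "wb v"]
    sum_point_masses[OF assms(2), of "wn v"]
  show "w0 v = w0 ?u \<and> wb v = wb ?u \<and> wn v = wn ?u"
    by (simp add: linear_sum[OF linear_weak_fun_components(1)] linear_sum[OF linear_weak_fun_components(2)]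
        linear_sum[OF linear_weak_fun_components(3)] cell_part_def trace_part_def normal_part_def sums 0)
qed

definition Vh_generators :: "(real^'n) mesh \<Rightarrow> nat \<Rightarrow> (real^'n) weak_fun set" where
  "Vh_generators M k = (\<Union>T\<in>cells M. cell_part T ` monomials k)
     \<union> (\<Union>e\<in>faces M. trace_part e ` restrict_zero e ` monomials k)
     \<union> (\<Union>e\<in>faces M. normal_part e ` restrict_zero e ` monomials (k - 1))"

lemma Vh_subset_span:
  assumes "finite (cells M)" "finite (faces M)"
  shows "Vh M k \<subseteq> span (Vh_generators M k)"
proof
  fix v assume v: "v \<in> Vh M k"
  have "cell_part T (w0 v T) \<in> span (Vh_generators M k)" if "T \<in> cells M" for T
  proof -
    have "w0 v T \<in> span (monomials k)" using v that poly_space_subset_span by (auto simp: Vh_def)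
    then have "cell_part T (w0 v T) \<in> span (cell_part T ` monomials k)"
      by (simp add: linear_span_image[OF linear_parts(1)])
    then show ?thesis by (rule span_mono[THEN subsetD, rotated]) (use that in \<open>auto simp: Vh_generators_def\<close>)
  qed
  moreover have "trace_part e (wb v e) \<in> span (Vh_generators M k)" if "e \<in> faces M" for e
  proof -
    have "wb v e \<in> span (restrict_zero e ` monomials k)"
      using v that by (intro poly_space_on_subset_span[THEN subsetD]) (simp add: Vh_def)
    then have "trace_part e (wb v e) \<in> span (trace_part e ` restrict_zero e ` monomials k)"
      by (simp add: linear_span_image[OF linear_parts(2)])
    then show ?thesis by (rule span_mono[THEN subsetD, rotated]) (use that in \<open>auto simp: Vh_generators_def\<close>)
  qed
  moreover have "normal_part e (wn v e) \<in> span (Vh_generators M k)" if "e \<in> faces M" for e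
  proof -
    have "wn v e \<in> span (restrict_zero e ` monomials (k - 1))"
      using v that by (intro poly_space_on_subset_span[THEN subsetD]) (simp add: Vh_def)
    then have "normal_part e (wn v e) \<in> span (normal_part e ` restrict_zero e ` monomials (k - 1))"
      by (simp add: linear_span_image[OF linear_parts(3)])
    then show ?thesis by (rule span_mono[THEN subsetD, rotated]) (use that in \<open>auto simp: Vh_generators_def\<close>)
  qed
  ultimately show "v \<in> span (Vh_generators M k)"
    by (subst Vh_decomposition[OF assms v]) (intro span_add span_sum)
qed

lemma finite_Vh_generators:
  "finite (cells M) \<Longrightarrow> finite (faces M) \<Longrightarrow> finite (Vh_generators M k)"
  by (simp add: Vh_generators_def finite_monomials)

lemma subspace_Vh: "subspace (Vh M k)"
  by (rule subspaceI)
    (auto simp: Vh_def zero_fun_def[symmetric] simp del: One_nat_def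
      intro: subspace_0 subspace_add subspace_scale subspace_poly_space subspace_poly_space_on)

lemma subspace_Vh0: "subspace (Vh0 \<Omega> M k)"
  using subspace_Vh[of M k] by (auto simp: subspace_def Vh0_def)

lemma Vh0_subset: "Vh0 \<Omega> M k \<subseteq> Vh M k"
  by (auto simp: Vh0_def)

section \<open>Geometry of a mesh\<close>

lemma mesh_finite: "is_mesh \<Omega> M \<Longrightarrow> finite (cells M) \<and> finite (faces M)"
  by (simp add: is_mesh_def)

lemma mesh_cell:
  fixes M :: "(real^'n) mesh"
  assumes "is_mesh \<Omega> M" "T \<in> cells M"
  shows "polytopal (int CARD('n)) T" and "compact T" and "T \<subseteq> closure \<Omega>"
proof -
  show T: "polytopal (int CARD('n)) T" using assms by (simp add: is_mesh_def)
  then show "compact T" by (rule polytopal_compact)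
  show "T \<subseteq> closure \<Omega>" using assms by (auto simp: is_mesh_def)
qed

lemma mesh_face:
  fixes M :: "(real^'n) mesh"
  assumes "is_mesh \<Omega> M" "e \<in> faces M"
  shows "polytopal (int CARD('n) - 1) e" "norm (normal M e) = 1"
    "\<forall>x\<in>e. \<forall>y\<in>e. normal M e \<bullet> (x - y) = 0"
  using assms by (simp_all add: is_mesh_def)

lemma mesh_face_cell:
  "is_mesh \<Omega> M \<Longrightarrow> e \<in> faces M \<Longrightarrow> \<exists>T\<in>cells M. e \<in> cell_faces M T"
  by (simp add: is_mesh_def)

lemma mesh_outward_normal:
  "is_mesh \<Omega> M \<Longrightarrow> T \<in> cells M \<Longrightarrow> e \<in> cell_faces M T \<Longrightarrow> \<exists>n. is_outward_normal T e n"
  by (simp add: is_mesh_def)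

lemma finite_cell_faces: "is_mesh \<Omega> M \<Longrightarrow> finite (cell_faces M T)"
  by (simp add: is_mesh_def cell_faces_def)

lemma cell_faces_subset: "e \<in> cell_faces M T \<Longrightarrow> e \<in> faces M"
  by (simp add: cell_faces_def)

lemma cell_diameter_pos:
  fixes M :: "(real^'n) mesh"
  assumes "is_mesh \<Omega> M" "T \<in> cells M" shows "diameter T > 0"
proof -
  obtain x where "x \<in> interior T" using polytopal_interior_nonempty[OF mesh_cell(1)[OF assms]] by blast
  then obtain \<epsilon> where \<epsilon>: "\<epsilon> > 0" "cball x \<epsilon> \<subseteq> T" by (auto simp: mem_interior_cball)
  have "diameter (cball x \<epsilon>) \<le> diameter T"
    using \<epsilon>(2) compact_imp_bounded[OF mesh_cell(2)[OF assms]] by (rule diameter_subset)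
  then show ?thesis using \<epsilon>(1) by (simp add: diameter_cball)
qed

section \<open>The weak Laplacian\<close>

text \<open>The right-hand side of the equation that defines the weak Laplacian, as a form in \<open>v\<close> and the
  test polynomial \<open>\<phi>\<close>.\<close>

definition weak_laplacian_form ::
    "(real^'n) mesh \<Rightarrow> (real^'n) weak_fun \<Rightarrow> (real^'n) set \<Rightarrow> (real^'n \<Rightarrow> real) \<Rightarrow> real" where
  "weak_laplacian_form M v T \<phi> =
     (\<integral>x. w0 v T x * laplacian \<phi> x \<partial>lebesgue_on T)
     - (\<Sum>e\<in>cell_faces M T. \<integral>x. wb v e x * (grad \<phi> x \<bullet> outward_normal T e) \<partial>surf M e)
     + (\<Sum>e\<in>cell_faces M T.
          \<integral>x. wn v e x * (normal M e \<bullet> outward_normal T e) * \<phi> x \<partial>surf M e)"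

lemma weak_laplacian_form_integrable:
  assumes M: "is_mesh \<Omega> M" and T: "T \<in> cells M" and v: "v \<in> Vh M k" and \<phi>: "\<phi> \<in> poly_space r"
  shows "integrable (lebesgue_on T) (\<lambda>x. w0 v T x * laplacian \<phi> x)"
    and "e \<in> cell_faces M T \<Longrightarrow> integrable (surf M e) (\<lambda>x. wb v e x * (grad \<phi> x \<bullet> outward_normal T e))"
    and "e \<in> cell_faces M T \<Longrightarrow>
      integrable (surf M e) (\<lambda>x. wn v e x * (normal M e \<bullet> outward_normal T e) * \<phi> x)"
proof -
  have poly: "real_polynomial_function \<phi>" using \<phi> by (rule real_polynomial_function_poly_space)
  show "integrable (lebesgue_on T) (\<lambda>x. w0 v T x * laplacian \<phi> x)"
    using v T mesh_cell(2)[OF M T]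
    by (intro L2_product_integrable L2_cell_poly_space[where k = k] L2_cell_continuous continuous_laplacian poly)
      (auto simp: Vh_def)
  assume e: "e \<in> cell_faces M T"
  note face = mesh_face[OF M cell_faces_subset[OF e]]
  have ve: "wb v e \<in> poly_space_on k e" "wn v e \<in> poly_space_on (k - 1) e"
    using v cell_faces_subset[OF e] by (auto simp: Vh_def)
  show "integrable (surf M e) (\<lambda>x. wb v e x * (grad \<phi> x \<bullet> outward_normal T e))"
    by (intro face_integrable[OF face ve(1)] continuous_intros continuous_grad poly)
  show "integrable (surf M e) (\<lambda>x. wn v e x * (normal M e \<bullet> outward_normal T e) * \<phi> x)"
    unfolding mult.assoc
    by (intro face_integrable[OF face ve(2)] continuous_intros continuous_polynomial poly)
qed

lemma weak_laplacian_form_linear_test: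
  assumes M: "is_mesh \<Omega> M" and T: "T \<in> cells M" and v: "v \<in> Vh M k"
  shows "linear_form_on (poly_space r) (weak_laplacian_form M v T)"
  unfolding weak_laplacian_form_def
  by (intro linear_form_on_plus linear_form_on_minus linear_form_on_sum linear_form_on_integral
      weak_laplacian_form_integrable[OF M T v])
    (auto simp: laplacian_add laplacian_scaleR grad_add grad_scaleR real_polynomial_function_poly_space
      inner_add_left algebra_simps)

lemma weak_laplacian_form_linear:
  assumes M: "is_mesh \<Omega> M" and T: "T \<in> cells M" and \<phi>: "\<phi> \<in> poly_space r"
  shows "linear_form_on (Vh M k) (\<lambda>v. weak_laplacian_form M v T \<phi>)"
  unfolding weak_laplacian_form_def
  by (intro linear_form_on_plus linear_form_on_minus linear_form_on_sum linear_form_on_integral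
      weak_laplacian_form_integrable[OF M T _ \<phi>])
    (auto simp: algebra_simps)

lemma weak_laplacian_ex1:
  assumes M: "is_mesh \<Omega> M" and T: "T \<in> cells M" and v: "v \<in> Vh M k"
  shows "\<exists>!w. w \<in> poly_space r \<and>
    (\<forall>\<phi>\<in>poly_space r. (\<integral>x. w x * \<phi> x \<partial>lebesgue_on T) = weak_laplacian_form M v T \<phi>)"
  by (rule L2_ex1_representer[OF subspace_poly_space finite_monomials poly_space_subset_span
        L2_cell_poly_space[OF mesh_cell(2)[OF M T]] poly_space_definite_on_cell[OF mesh_cell(1)[OF M T]]
        weak_laplacian_form_linear_test[OF M T v]])

lemma weak_laplacian_characterization:
  assumes M: "is_mesh \<Omega> M" and T: "T \<in> cells M" and v: "v \<in> Vh M k"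
  shows "weak_laplacian M r v T \<in> poly_space r"
    and "\<phi> \<in> poly_space r \<Longrightarrow>
      (\<integral>x. weak_laplacian M r v T x * \<phi> x \<partial>lebesgue_on T) = weak_laplacian_form M v T \<phi>"
  using theI'[OF weak_laplacian_ex1[OF assms, of r]]
  unfolding weak_laplacian_def weak_laplacian_form_def by blast+

lemma weak_laplacian_eqI:
  assumes M: "is_mesh \<Omega> M" and T: "T \<in> cells M" and v: "v \<in> Vh M k" and w: "w \<in> poly_space r"
    and "\<And>\<phi>. \<phi> \<in> poly_space r \<Longrightarrow> (\<integral>x. w x * \<phi> x \<partial>lebesgue_on T) = weak_laplacian_form M v T \<phi>"
  shows "weak_laplacian M r v T = w"
  using weak_laplacian_ex1[OF M T v, of r] weak_laplacian_characterization[OF M T v] assms(4,5) by blast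

text \<open>By uniqueness: the combination of the weak Laplacians satisfies the equation that characterizes
  the weak Laplacian of the combination.\<close>

lemma weak_laplacian_linear:
  assumes M: "is_mesh \<Omega> M" and T: "T \<in> cells M" and u: "u \<in> Vh M k" and v: "v \<in> Vh M k"
  shows "weak_laplacian M r (u + v) T = weak_laplacian M r u T + weak_laplacian M r v T"
    and "weak_laplacian M r (c *\<^sub>R v) T = c *\<^sub>R weak_laplacian M r v T"
proof -
  have lin: "linear_form_on (poly_space r) (\<lambda>p. \<integral>x. p x * \<phi> x \<partial>lebesgue_on T)"
    if "\<phi> \<in> poly_space r" for \<phi>
    using bilinear_form_on_integral_product[OF L2_cell_poly_space[OF mesh_cell(2)[OF M T]]] that
    by (auto simp: bilinear_form_on_def)
  note char = weak_laplacian_characterization[OF M T]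
  show "weak_laplacian M r (u + v) T = weak_laplacian M r u T + weak_laplacian M r v T"
  proof (rule weak_laplacian_eqI[OF M T subspace_add[OF subspace_Vh u v]])
    show "weak_laplacian M r u T + weak_laplacian M r v T \<in> poly_space r"
      using subspace_poly_space char(1)[OF u] char(1)[OF v] by (rule subspace_add)
    show "(\<integral>x. (weak_laplacian M r u T + weak_laplacian M r v T) x * \<phi> x \<partial>lebesgue_on T)
        = weak_laplacian_form M (u + v) T \<phi>" if "\<phi> \<in> poly_space r" for \<phi>
      unfolding linear_form_on_add[OF lin[OF that] char(1)[OF u] char(1)[OF v]]
        char(2)[OF u that] char(2)[OF v that]
        linear_form_on_add[OF weak_laplacian_form_linear[OF M T that] u v] ..
  qed
  show "weak_laplacian M r (c *\<^sub>R v) T = c *\<^sub>R weak_laplacian M r v T"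
  proof (rule weak_laplacian_eqI[OF M T subspace_scale[OF subspace_Vh v]])
    show "c *\<^sub>R weak_laplacian M r v T \<in> poly_space r"
      using subspace_poly_space char(1)[OF v] by (rule subspace_scale)
    show "(\<integral>x. (c *\<^sub>R weak_laplacian M r v T) x * \<phi> x \<partial>lebesgue_on T)
        = weak_laplacian_form M (c *\<^sub>R v) T \<phi>" if "\<phi> \<in> poly_space r" for \<phi>
      unfolding linear_form_on_scale[OF lin[OF that] char(1)[OF v]] char(2)[OF v that]
        linear_form_on_scale[OF weak_laplacian_form_linear[OF M T that] v] ..
  qed
qed

section \<open>One time step\<close>

lemma mesh_inner_linear:
  assumes "\<And>v T. v \<in> V \<Longrightarrow> T \<in> cells M \<Longrightarrow> L2 (lebesgue_on T) (G v T)"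
    and "\<And>T. T \<in> cells M \<Longrightarrow> L2 (lebesgue_on T) (g T)"
    and "\<And>u v T. u \<in> V \<Longrightarrow> v \<in> V \<Longrightarrow> T \<in> cells M \<Longrightarrow> G (u + v) T = G u T + G v T"
    and "\<And>c v T. v \<in> V \<Longrightarrow> T \<in> cells M \<Longrightarrow> G (c *\<^sub>R v) T = c *\<^sub>R G v T"
  shows "linear_form_on V (\<lambda>v. mesh_inner M (G v) g)" "linear_form_on V (\<lambda>v. mesh_inner M g (G v))"
  unfolding mesh_inner_def using assms
  by (intro linear_form_on_sum linear_form_on_integral; simp add: L2_product_integrable algebra_simps)+

lemma mesh_inner_nonneg: "mesh_inner M g g \<ge> 0"
  by (auto simp: mesh_inner_def intro!: sum_nonneg integral_nonneg_AE)

context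
  fixes \<Omega> :: "(real^'n) set" and M :: "(real^'n) mesh" and k r :: nat
  assumes mesh: "is_mesh \<Omega> M"
begin

private lemma L2_w0: "v \<in> Vh M k \<Longrightarrow> T \<in> cells M \<Longrightarrow> L2 (lebesgue_on T) (w0 v T)"
  by (rule L2_cell_poly_space[OF mesh_cell(2)[OF mesh]]) (auto simp: Vh_def)

private lemma L2_weak_laplacian:
  "v \<in> Vh M k \<Longrightarrow> T \<in> cells M \<Longrightarrow> L2 (lebesgue_on T) (weak_laplacian M r v T)"
  by (rule L2_cell_poly_space[OF mesh_cell(2)[OF mesh] weak_laplacian_characterization(1)[OF mesh]])

lemma mesh_inner_w0_linear:
  assumes "\<And>T. T \<in> cells M \<Longrightarrow> L2 (lebesgue_on T) (g T)"
  shows "linear_form_on (Vh M k) (\<lambda>v. mesh_inner M (w0 v) g)"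
    and "linear_form_on (Vh M k) (\<lambda>v. mesh_inner M g (w0 v))"
  using assms by (intro mesh_inner_linear; simp add: L2_w0)+

lemma mesh_inner_weak_laplacian_linear:
  assumes "\<And>T. T \<in> cells M \<Longrightarrow> L2 (lebesgue_on T) (g T)"
  shows "linear_form_on (Vh M k) (\<lambda>v. mesh_inner M (weak_laplacian M r v) g)"
    and "linear_form_on (Vh M k) (\<lambda>v. mesh_inner M g (weak_laplacian M r v))"
  using assms
  by (intro mesh_inner_linear; simp add: L2_weak_laplacian weak_laplacian_linear[OF mesh, where k = k])+

text \<open>The seminorm \<open>norm_2h\<close> controls only \<open>\<Delta> v\<^sub>0\<close> and the mismatch of the components of \<open>v\<close> on
  cell boundaries.  Once \<open>v\<^sub>0 = 0\<close>, this mismatch is, up to sign, \<open>v\<^sub>b\<close> and \<open>v\<^sub>n n\<^sub>e \<bullet> n\<close>, and every face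
  belongs to some cell.\<close>

lemma norm_2h_definite:
  assumes v: "v \<in> Vh M k" and v0: "mesh_inner M (w0 v) (w0 v) = 0" and norm: "norm_2h M v \<le> 0"
  shows "v = 0"
proof -
  have fin: "finite (cells M)" using mesh_finite[OF mesh] by blast
  have w0: "w0 v T = 0" for T
  proof (cases "T \<in> cells M")
    case True
    have "(\<Sum>T\<in>cells M. \<integral>x. (w0 v T x)\<^sup>2 \<partial>lebesgue_on T) = 0"
      using v0 by (simp add: mesh_inner_def power2_eq_square)
    then have "(\<integral>x. (w0 v T x)\<^sup>2 \<partial>lebesgue_on T) = 0"
      using True by (simp add: sum_nonneg_eq_0_iff[OF fin])
    moreover have "w0 v T \<in> poly_space k" using True v by (simp add: Vh_def)
    ultimately show ?thesis
      using poly_space_definite_on_cell[OF mesh_cell(1)[OF mesh True]] by blast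
  next
    case False
    then show ?thesis using v by (simp add: Vh_def zero_fun_def)
  qed
  have faces: "wb v e = 0 \<and> wn v e = 0" for e
  proof (cases "e \<in> faces M")
    case True
    then obtain T where T: "T \<in> cells M" "e \<in> cell_faces M T"
      using mesh_face_cell[OF mesh] by blast
    note face = mesh_face[OF mesh True]
    define b where "b T = (\<Sum>e\<in>cell_faces M T. \<integral>x. (w0 v T x - wb v e x)\<^sup>2 \<partial>surf M e)" for T
    define c where "c T = (\<Sum>e\<in>cell_faces M T. \<integral>x. ((grad (w0 v T) x - wn v e x *\<^sub>R normal M e)
      \<bullet> outward_normal T e)\<^sup>2 \<partial>surf M e)" for T
    define a where "a T = (\<integral>x. (laplacian (w0 v T) x)\<^sup>2 \<partial>lebesgue_on T)" for T
    have nonneg: "a T \<ge> 0" "b T \<ge> 0" "c T \<ge> 0" for T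
      unfolding a_def b_def c_def by (auto intro!: sum_nonneg)
    have d: "diameter T > 0" if "T \<in> cells M" for T using cell_diameter_pos[OF mesh that] .
    have "(\<Sum>T\<in>cells M. a T + b T / diameter T ^ 3 + c T / diameter T) \<le> 0"
      using norm by (simp add: norm_2h_def a_def b_def c_def)
    moreover have summand: "a T + b T / diameter T ^ 3 + c T / diameter T \<ge> 0" if "T \<in> cells M" for T
      using nonneg[of T] d[OF that] by simp
    ultimately have "(\<Sum>T\<in>cells M. a T + b T / diameter T ^ 3 + c T / diameter T) = 0"
      by (meson antisym sum_nonneg)
    then have "a T + b T / diameter T ^ 3 + c T / diameter T = 0"
      using T(1) summand fin by (simp add: sum_nonneg_eq_0_iff)
    moreover have "b T / diameter T ^ 3 \<ge> 0" "c T / diameter T \<ge> 0" using nonneg[of T] d[OF T(1)] by simp_all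
    ultimately have "b T / diameter T ^ 3 = 0" "c T / diameter T = 0" using nonneg(1)[of T] by linarith+
    then have bc: "b T = 0" "c T = 0" using d[OF T(1)] by simp_all
    have "(\<integral>x. (w0 v T x - wb v e x)\<^sup>2 \<partial>surf M e) = 0"
      using bc(1) T(2) unfolding b_def by (simp add: sum_nonneg_eq_0_iff[OF finite_cell_faces[OF mesh]])
    then have "(\<integral>x. (wb v e x)\<^sup>2 \<partial>surf M e) = 0" by (simp add: w0)
    moreover have "wb v e \<in> poly_space_on k e" using True v by (simp add: Vh_def)
    ultimately have wb: "wb v e = 0" using poly_space_on_definite[OF face] by blast
    have "(\<integral>x. ((grad (w0 v T) x - wn v e x *\<^sub>R normal M e) \<bullet> outward_normal T e)\<^sup>2 \<partial>surf M e) = 0"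
      using bc(2) T(2) unfolding c_def by (simp add: sum_nonneg_eq_0_iff[OF finite_cell_faces[OF mesh]])
    moreover have "grad (w0 v T) x = 0" for x
      using grad_scaleR[of "\<lambda>_. 0" 0 x] by (simp add: w0 real_polynomial_function.intros(2))
    ultimately have "(\<integral>x. (wn v e x)\<^sup>2 * (normal M e \<bullet> outward_normal T e)\<^sup>2 \<partial>surf M e) = 0"
      by (simp add: power_mult_distrib)
    moreover have "normal M e \<bullet> outward_normal T e \<noteq> 0"
      by (rule normal_inner_outward_normal[OF face mesh_outward_normal[OF mesh T]])
    ultimately have "(\<integral>x. (wn v e x)\<^sup>2 \<partial>surf M e) = 0" by simp
    moreover have "wn v e \<in> poly_space_on (k - 1) e" using True v by (simp add: Vh_def)
    ultimately have "wn v e = 0" using poly_space_on_definite[OF face] by blast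
    with wb show ?thesis ..
  next
    case False
    then show ?thesis using v by (simp add: Vh_def zero_fun_def)
  qed
  show ?thesis
    by (rule weak_fun.expand) (use w0 faces in \<open>auto simp: fun_eq_iff\<close>)
qed

text \<open>Moving the terms with the known function \<open>w\<close> to the right leaves the variational problem
  \<open>a u v = L v\<close> with \<open>a u v = (u\<^sub>0, v\<^sub>0) / \<tau> + \<theta> (\<Delta>\<^sub>w u, \<Delta>\<^sub>w v)\<close>.  If \<open>a u u = 0\<close>, both nonnegative summands vanish:
  the first gives \<open>u\<^sub>0 = 0\<close>, the second that \<open>u\<close> has energy norm zero.  The bound of \<open>norm_2h\<close> by the
  energy norm then makes \<open>u\<close> zero, so \<open>a\<close> is definite.\<close>

lemma theta_step_ex1:
  assumes C: "C > 0" "\<And>v. v \<in> Vh M k \<Longrightarrow> C * norm_2h M v \<le> energy_norm M r v"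
    and \<tau>: "\<tau> > 0" and \<theta>: "\<theta> > 0" and w: "w \<in> Vh M k"
    and g: "\<And>T. T \<in> cells M \<Longrightarrow> L2 (lebesgue_on T) (g T)"
  shows "\<exists>!u. u \<in> Vh0 \<Omega> M k \<and> (\<forall>v\<in>Vh0 \<Omega> M k.
    mesh_inner M (w0 ((u - w) /\<^sub>R \<tau>)) (w0 v)
      + mesh_inner M (weak_laplacian M r (\<theta> *\<^sub>R u + (1 - \<theta>) *\<^sub>R w)) (weak_laplacian M r v)
    = mesh_inner M g (w0 v))"
proof -
  define a where "a u v = inverse \<tau> * mesh_inner M (w0 u) (w0 v)
    + \<theta> * mesh_inner M (weak_laplacian M r u) (weak_laplacian M r v)" for u v
  define L where "L v = mesh_inner M g (w0 v) + (inverse \<tau> * mesh_inner M (w0 w) (w0 v)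
    - (1 - \<theta>) * mesh_inner M (weak_laplacian M r w) (weak_laplacian M r v))" for v
  have equation: "mesh_inner M (w0 ((u - w) /\<^sub>R \<tau>)) (w0 v)
      + mesh_inner M (weak_laplacian M r (\<theta> *\<^sub>R u + (1 - \<theta>) *\<^sub>R w)) (weak_laplacian M r v)
      = mesh_inner M g (w0 v) \<longleftrightarrow> a u v = L v"
    if u: "u \<in> Vh M k" and v: "v \<in> Vh M k" for u v
  proof -
    note lin0 = mesh_inner_w0_linear(1)[OF L2_w0[OF v]]
    note lin1 = mesh_inner_weak_laplacian_linear(1)[OF L2_weak_laplacian[OF v]]
    note V = subspace_Vh[of M k]
    have "mesh_inner M (w0 ((u - w) /\<^sub>R \<tau>)) (w0 v)
        = inverse \<tau> * (mesh_inner M (w0 u) (w0 v) - mesh_inner M (w0 w) (w0 v))"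
      using linear_form_on_scale[OF lin0 subspace_diff[OF V u w]] linear_form_on_diff[OF V lin0 u w]
      by (simp del: weak_fun_components)
    moreover have "mesh_inner M (weak_laplacian M r (\<theta> *\<^sub>R u + (1 - \<theta>) *\<^sub>R w)) (weak_laplacian M r v)
        = \<theta> * mesh_inner M (weak_laplacian M r u) (weak_laplacian M r v)
          + (1 - \<theta>) * mesh_inner M (weak_laplacian M r w) (weak_laplacian M r v)"
      using linear_form_on_add[OF lin1 subspace_scale[OF V u] subspace_scale[OF V w]]
        linear_form_on_scale[OF lin1 u] linear_form_on_scale[OF lin1 w] by simp
    ultimately show ?thesis by (auto simp: a_def L_def algebra_simps)
  qed
  have "bilinear_form_on (Vh0 \<Omega> M k) a"
  proof (rule bilinear_form_onI)
    fix v assume "v \<in> Vh0 \<Omega> M k"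
    then have v: "v \<in> Vh M k" using Vh0_subset by blast
    show "linear_form_on (Vh0 \<Omega> M k) (\<lambda>u. a u v)"
      unfolding a_def
      by (intro linear_form_on_subset[OF _ Vh0_subset] linear_form_on_plus linear_form_on_times
          mesh_inner_w0_linear(1) mesh_inner_weak_laplacian_linear(1) L2_w0 L2_weak_laplacian v)
    show "linear_form_on (Vh0 \<Omega> M k) (a v)"
      unfolding a_def
      by (intro linear_form_on_subset[OF _ Vh0_subset] linear_form_on_plus linear_form_on_times
          mesh_inner_w0_linear(2) mesh_inner_weak_laplacian_linear(2) L2_w0 L2_weak_laplacian v)
  qed
  moreover have "linear_form_on (Vh0 \<Omega> M k) L"
    unfolding L_def using w
    by (intro linear_form_on_subset[OF _ Vh0_subset] linear_form_on_plus linear_form_on_minus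
        linear_form_on_times mesh_inner_w0_linear mesh_inner_weak_laplacian_linear L2_w0 L2_weak_laplacian g)
  moreover have "u = 0" if "u \<in> Vh0 \<Omega> M k" "a u u = 0" for u
  proof -
    have u: "u \<in> Vh M k" using that(1) Vh0_subset by blast
    have "inverse \<tau> * mesh_inner M (w0 u) (w0 u) \<ge> 0"
      "\<theta> * mesh_inner M (weak_laplacian M r u) (weak_laplacian M r u) \<ge> 0"
      using \<tau> \<theta> by (auto intro!: mult_nonneg_nonneg mesh_inner_nonneg)
    then have "inverse \<tau> * mesh_inner M (w0 u) (w0 u) = 0"
      "\<theta> * mesh_inner M (weak_laplacian M r u) (weak_laplacian M r u) = 0"
      using that(2) unfolding a_def by linarith+
    then have 0: "mesh_inner M (w0 u) (w0 u) = 0" "energy_norm M r u = 0"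
      using \<tau> \<theta> by (auto simp: energy_norm_def)
    then have "norm_2h M u \<le> 0" using C(2)[OF u] C(1) by (simp add: mult_le_0_iff)
    then show ?thesis by (rule norm_2h_definite[OF u 0(1)])
  qed
  moreover have "finite (Vh_generators M k)" "Vh0 \<Omega> M k \<subseteq> span (Vh_generators M k)"
    using mesh_finite[OF mesh] finite_Vh_generators[of M k] Vh_subset_span[of M k] Vh0_subset by blast+
  ultimately have "\<exists>!u. u \<in> Vh0 \<Omega> M k \<and> (\<forall>v\<in>Vh0 \<Omega> M k. a u v = L v)"
    by (intro ex1_representer[OF subspace_Vh0])
  moreover have "(u \<in> Vh0 \<Omega> M k \<and> (\<forall>v\<in>Vh0 \<Omega> M k. a u v = L v)) \<longleftrightarrow>
    (u \<in> Vh0 \<Omega> M k \<and> (\<forall>v\<in>Vh0 \<Omega> M k.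
    mesh_inner M (w0 ((u - w) /\<^sub>R \<tau>)) (w0 v)
      + mesh_inner M (weak_laplacian M r (\<theta> *\<^sub>R u + (1 - \<theta>) *\<^sub>R w)) (weak_laplacian M r v)
    = mesh_inner M g (w0 v)))" for u
    using equation Vh0_subset by blast
  ultimately show ?thesis by simp
qed

section \<open>The initial value\<close>

text \<open>The default value 0 of \<open>face_trace\<close> is square integrable as well.\<close>

lemma L2_face_trace: "L2 \<mu> (face_trace \<Omega>' \<mu> B u)"
proof (cases "\<exists>g. is_face_trace \<Omega>' \<mu> B u g")
  case True
  then have "is_face_trace \<Omega>' \<mu> B u (face_trace \<Omega>' \<mu> B u)"
    unfolding face_trace_def by (simp add: someI_ex)
  then show ?thesis by (simp add: is_face_trace_def)
next
  case False
  then show ?thesis by (simp add: face_trace_def L2_def)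
qed

text \<open>The first time step applies the weak Laplacian to a combination with the initial value, so that
  linearity on \<open>V\<^sub>h\<close> is available only if the initial value lies in this space.\<close>

lemma Qh_in_Vh:
  assumes \<Omega>: "polytopal_domain \<Omega>" and u: "L2 (lebesgue_on \<Omega>) u"
  shows "Qh \<Omega> M k u \<in> Vh M k"
proof -
  have "L2_proj (lebesgue_on T) (poly_space k) u \<in> poly_space k" if T: "T \<in> cells M" for T
    by (rule L2_proj_in[OF subspace_poly_space finite_monomials poly_space_subset_span
          L2_cell_poly_space[OF mesh_cell(2)[OF mesh T]] poly_space_definite_on_cell[OF mesh_cell(1)[OF mesh T]]
          L2_restrict_cell[OF \<Omega> mesh_cell(2,3)[OF mesh T] u]])
  moreover have "L2_proj (surf M e) (poly_space_on j e) (face_trace \<Omega> (surf M e) B u) \<in> poly_space_on j e"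
    if e: "e \<in> faces M" for e j B
    by (rule L2_proj_in[OF subspace_poly_space_on finite_imageI[OF finite_monomials] poly_space_on_subset_span
          L2_face_poly_space[OF mesh_face[OF mesh e]] poly_space_on_definite[OF mesh_face[OF mesh e]]
          L2_face_trace])
  ultimately show ?thesis by (simp add: Qh_def Vh_def)
qed

end

section \<open>The sequence of time steps\<close>

text \<open>Two sets of states are distinguished because the initial value is only known to lie in \<open>V\<close>, whereas
  every step leads into the smaller set \<open>W\<close>.\<close>

lemma ex1_recursive_sequence:
  assumes q: "q \<in> V" and W: "W \<subseteq> V"
    and step: "\<And>n w. n \<in> {1..N} \<Longrightarrow> w \<in> V \<Longrightarrow> \<exists>!u. u \<in> W \<and> S n w u"
  shows "\<exists>!U :: nat \<Rightarrow> 'a. U \<in> extensional {0..N} \<and> U 0 = q \<and> (\<forall>n\<in>{1..N}. U n \<in> W \<and> S n (U (n - 1)) (U n))"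
proof -
  define R where "R = rec_nat q (\<lambda>n w. THE u. u \<in> W \<and> S (Suc n) w u)"
  have R_Suc: "R (Suc n) \<in> W \<and> S (Suc n) (R n) (R (Suc n))" if "R n \<in> V" "Suc n \<le> N" for n
    using theI'[OF step[of "Suc n" "R n"]] that by (simp add: R_def)
  have "R n \<in> V" if "n \<le> N" for n
    using that
  proof (induction n)
    case 0
    show ?case using q by (simp add: R_def)
  next
    case (Suc n)
    then have "R (Suc n) \<in> W" using R_Suc[of n] by simp
    then show ?case using W by blast
  qed
  then have R: "R n \<in> W \<and> S n (R (n - 1)) (R n)" if "n \<in> {1..N}" for n
  proof -
    obtain m where "n = Suc m" "m \<le> N" "Suc m \<le> N"
      using \<open>n \<in> {1..N}\<close> by (cases n) auto
    then show ?thesis using R_Suc[of m] \<open>\<And>n. n \<le> N \<Longrightarrow> R n \<in> V\<close> by simp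
  qed
  have unique: "U n = U' n \<and> U n \<in> V"
    if "U 0 = q" "\<forall>n\<in>{1..N}. U n \<in> W \<and> S n (U (n - 1)) (U n)"
      "U' 0 = q" "\<forall>n\<in>{1..N}. U' n \<in> W \<and> S n (U' (n - 1)) (U' n)" "n \<le> N" for U U' n
    using that(5)
  proof (induction n)
    case 0
    show ?case using that q by simp
  next
    case (Suc n)
    then have IH: "U n = U' n" "U n \<in> V" by auto
    have n: "Suc n \<in> {1..N}" using Suc.prems by simp
    have "U (Suc n) \<in> W \<and> S (Suc n) (U n) (U (Suc n))"
      using bspec[OF that(2) n] by simp
    moreover have "U' (Suc n) \<in> W \<and> S (Suc n) (U n) (U' (Suc n))"
      using bspec[OF that(4) n] IH(1) by simp
    ultimately show ?case using step[OF n IH(2)] W by blast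
  qed
  show ?thesis
  proof (rule ex1I[of _ "restrict R {0..N}"])
    have "R 0 = q" by (simp add: R_def)
    moreover have "restrict R {0..N} n \<in> W \<and> S n (restrict R {0..N} (n - 1)) (restrict R {0..N} n)"
      if n: "n \<in> {1..N}" for n
    proof -
      have "n \<in> {0..N}" "n - 1 \<in> {0..N}" using n by auto
      then show ?thesis using R[OF n] by (simp only: restrict_apply if_True)
    qed
    ultimately show R': "restrict R {0..N} \<in> extensional {0..N} \<and> restrict R {0..N} 0 = q \<and>
      (\<forall>n\<in>{1..N}. restrict R {0..N} n \<in> W \<and> S n (restrict R {0..N} (n - 1)) (restrict R {0..N} n))"
      by simp
    show "U = restrict R {0..N}"
      if U: "U \<in> extensional {0..N} \<and> U 0 = q \<and> (\<forall>n\<in>{1..N}. U n \<in> W \<and> S n (U (n - 1)) (U n))" for U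
    proof (rule extensionalityI[of _ "{0..N}"])
      fix n assume "n \<in> {0..N}"
      then have "n \<le> N" by simp
      from U R' show "U n = restrict R {0..N} n"
        by (elim conjE) (rule unique[THEN conjunct1, OF _ _ _ _ \<open>n \<le> N\<close>])
    qed (use U in auto)
  qed
qed

theorem theorem3p8:
  fixes \<Omega> :: "(real^'n) set" and \<M> :: "(real^'n) mesh set" and M :: "(real^'n) mesh"
    and k r N :: nat and tbar \<tau> \<theta> :: real
    and f :: "real \<Rightarrow> real^'n \<Rightarrow> real" and \<psi> :: "real^'n \<Rightarrow> real"
  assumes "CARD('n) = 2 \<or> CARD('n) = 3"
    and "polytopal_domain \<Omega>"
    and "\<forall>M\<in>\<M>. is_mesh \<Omega> M"
    and "shape_regular_family \<M>"
    and "k \<ge> 2"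
    and "norms_equivalent \<M> k r"
    and "M \<in> \<M>"
    and "tbar > 0" and "\<tau> > 0" and "real N * \<tau> = tbar"
    and "\<forall>t\<in>{0..tbar}. L2 (lebesgue_on \<Omega>) (f t)"
    and "\<psi> \<in> H2_0 \<Omega>"
    and "\<theta> \<in> {1/2..1}"
  shows "\<exists>!U :: nat \<Rightarrow> (real^'n) weak_fun. U \<in> extensional {0..N} \<and>
    U 0 = Qh \<Omega> M k \<psi> \<and>
    (\<forall>n\<in>{1..N}. U n \<in> Vh0 \<Omega> M k \<and>
      (\<forall>v\<in>Vh0 \<Omega> M k.
        mesh_inner M (w0 ((U n - U (n - 1)) /\<^sub>R \<tau>)) (w0 v)
        + mesh_inner M (weak_laplacian M r (\<theta> *\<^sub>R U n + (1 - \<theta>) *\<^sub>R U (n - 1)))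
            (weak_laplacian M r v)
        = mesh_inner M
            (\<lambda>_ x. \<theta> * f (real n * \<tau>) x + (1 - \<theta>) * f (real (n - 1) * \<tau>) x) (w0 v)))"
proof (rule ex1_recursive_sequence[where V = "Vh M k" and S = "\<lambda>n w u. \<forall>v\<in>Vh0 \<Omega> M k.
    mesh_inner M (w0 ((u - w) /\<^sub>R \<tau>)) (w0 v)
      + mesh_inner M (weak_laplacian M r (\<theta> *\<^sub>R u + (1 - \<theta>) *\<^sub>R w)) (weak_laplacian M r v)
    = mesh_inner M (\<lambda>_ x. \<theta> * f (real n * \<tau>) x + (1 - \<theta>) * f (real (n - 1) * \<tau>) x) (w0 v)"])
  have mesh: "is_mesh \<Omega> M" using assms(3,7) by blast
  have "L2 (lebesgue_on \<Omega>) \<psi>" using assms(12) by (simp add: H2_0_def H2_def)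
  then show "Qh \<Omega> M k \<psi> \<in> Vh M k" by (rule Qh_in_Vh[OF mesh assms(2)])
  show "Vh0 \<Omega> M k \<subseteq> Vh M k" by (rule Vh0_subset)
  obtain C where C: "C > 0" "\<And>v. v \<in> Vh M k \<Longrightarrow> C * norm_2h M v \<le> energy_norm M r v"
    using assms(6,7) unfolding norms_equivalent_def by blast
  fix n w assume n: "n \<in> {1..N}" and w: "w \<in> Vh M k"
  have f: "L2 (lebesgue_on \<Omega>) (f (real m * \<tau>))" if "m \<le> N" for m
  proof -
    have "real m * \<tau> \<le> real N * \<tau>" using that assms(9) by (simp add: mult_right_mono)
    then have "real m * \<tau> \<in> {0..tbar}" using assms(9,10) by simp
    then show ?thesis using assms(11) by blast
  qed
  have "L2 (lebesgue_on \<Omega>) (\<lambda>x. \<theta> * f (real n * \<tau>) x + (1 - \<theta>) * f (real (n - 1) * \<tau>) x)"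
    using n by (intro L2_add L2_times f) auto
  then have "L2 (lebesgue_on T) (\<lambda>x. \<theta> * f (real n * \<tau>) x + (1 - \<theta>) * f (real (n - 1) * \<tau>) x)"
    if "T \<in> cells M" for T
    by (rule L2_restrict_cell[OF assms(2) mesh_cell(2,3)[OF mesh that]])
  then show "\<exists>!u. u \<in> Vh0 \<Omega> M k \<and> (\<forall>v\<in>Vh0 \<Omega> M k.
    mesh_inner M (w0 ((u - w) /\<^sub>R \<tau>)) (w0 v)
      + mesh_inner M (weak_laplacian M r (\<theta> *\<^sub>R u + (1 - \<theta>) *\<^sub>R w)) (weak_laplacian M r v)
    = mesh_inner M (\<lambda>_ x. \<theta> * f (real n * \<tau>) x + (1 - \<theta>) * f (real (n - 1) * \<tau>) x) (w0 v))"
    using assms(9,13) by (intro theta_step_ex1[OF mesh C _ _ w]) auto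
qed

end
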